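(* Let $0<\beta<1$, $x_0>0$, $0\le\mu<1$ and $p>1/\beta$. Assume: (1) $\phi$ is a nonnegative, continuous and nondecreasing function on $[0,+\infty)$, and there exists a nonnegative constant $M$ such that $|\phi(t)|\le M t^{\mu}$ for all $t\in[0,+\infty)$; (2) $t^{\beta}l(t)$ is a nonnegative, continuous and nonincreasing function on $(0,+\infty)$, and $t^{(1-\mu)(1-\beta)}l(t)\in L^{p}[0,1]$; (3) $t^{\beta}k(t)$ is a nonnegative, continuous and nonincreasing function on $(0,+\infty)$, and $t^{1-\beta}k(t)\in L^{p}[0,1]$. Let $a=\lim_{t\to+\infty}t^{\beta}l(t)$ and $b=\lim_{t\to+\infty}t^{\beta}k(t)$ (these limits exist by monotonicity), and assume $a=b=0$. Then the Riemann-Liouville fractional differential equation $$D_{0^{+}}^{\beta}x(t)=l(t)\phi(x(t))+k(t),\quad t\in(0,+\infty),\qquad \lim_{t\to0^{+}}t^{1-\beta}x(t)=x_{0},$$ has at least one decreasing solution $x\in C^{+}_{1-\beta}(0,+\infty)$ with $\lim_{t\to+\infty}x(t)=0$.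
   Context: The Riemann-Liouville fractional integral of order $\alpha\in(0,1)$ is $I_{0^{+}}^{\alpha}\rho(t)=\frac{1}{\Gamma(\alpha)}\int_{0}^{t}(t-s)^{\alpha-1}\rho(s)\,ds$. The Riemann-Liouville fractional derivative of order $\beta\in(0,1)$ is $D_{0^{+}}^{\beta}\rho(t)=\frac{d}{dt}I_{0^{+}}^{1-\beta}\rho(t)=\frac{1}{\Gamma(1-\beta)}\frac{d}{dt}\int_{0}^{t}(t-s)^{-\beta}\rho(s)\,ds$, where $I_{0^{+}}^{1-\beta}\rho$ is an absolutely continuous function. For $\alpha\in(0,1)$, $C^{+}_{\alpha}(0,+\infty)$ is the set of nonnegative continuous functions $x$ on $(0,+\infty)$ such that $t^{\alpha}x(t)$ is (extends to) a nonnegative continuous function on $[0,+\infty)$. A solution is a function satisfying both the differential equation for all $t\in(0,+\infty)$ and the initial condition. "Decreasing" means strictly decreasing, as distinguished from "nonincreasing". When $\mu=0$, $t^{\mu}=1$ for all $t\ge0$, including $t=0$. *)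

theory Defs
  imports "HOL-Analysis.Analysis"
begin

text \<open>
  Functions on \<open>[0, \<infinity>)\<close> or \<open>(0, \<infinity>)\<close> are total functions \<open>real \<Rightarrow> real\<close>; only their values on
  the relevant domain are ever constrained or used (up to null sets, for integrals).
\<close>

text \<open>
  The power \<open>t\<^sup>\<mu>\<close> for \<open>t \<ge> 0\<close>, \<open>\<mu> \<ge> 0\<close> with the convention \<open>0\<^sup>0 = 1\<close>; note that \<open>0 powr 0 = 0\<close>.
\<close>
definition npow :: "real \<Rightarrow> real \<Rightarrow> real" where
  "npow t \<mu> = (if \<mu> = 0 then 1 else t powr \<mu>)"

definition in_Lp :: "real \<Rightarrow> real set \<Rightarrow> (real \<Rightarrow> real) \<Rightarrow> bool" where
  "in_Lp p S f \<longleftrightarrow> f \<in> borel_measurable (lebesgue_on S) \<and>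
     integrable (lebesgue_on S) (\<lambda>t. \<bar>f t\<bar> powr p)"

text \<open>
  Absolute continuity on an interval \<open>S\<close>. For a half-open interval \<open>(0, T]\<close> this says precisely
  that \<open>f\<close> extends to an absolutely continuous function on \<open>[0, T]\<close>.
\<close>
definition abs_continuous_on :: "real set \<Rightarrow> (real \<Rightarrow> real) \<Rightarrow> bool" where
  "abs_continuous_on S f \<longleftrightarrow>
     (\<forall>\<epsilon>>0. \<exists>\<delta>>0. \<forall>(n::nat) (u :: nat \<Rightarrow> real) (v :: nat \<Rightarrow> real).
        (\<forall>i<n. u i \<le> v i \<and> {u i..v i} \<subseteq> S) \<longrightarrow>
        disjoint_family_on (\<lambda>i. {u i<..<v i}) {..<n} \<longrightarrow>
        (\<Sum>i<n. v i - u i) < \<delta> \<longrightarrow>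
        (\<Sum>i<n. \<bar>f (v i) - f (u i)\<bar>) < \<epsilon>)"

definition RL_integral :: "real \<Rightarrow> (real \<Rightarrow> real) \<Rightarrow> real \<Rightarrow> real" where
  "RL_integral \<alpha> \<rho> t =
     1 / Gamma \<alpha> * (LINT s:{0<..<t}|lebesgue. (t - s) powr (\<alpha> - 1) * \<rho> s)"

text \<open>
  \<open>D\<^sup>\<beta>\<rho>\<close> is meaningful when the integrals defining \<open>I\<^sup>1\<^sup>-\<^sup>\<beta>\<rho>\<close> converge and \<open>I\<^sup>1\<^sup>-\<^sup>\<beta>\<rho>\<close> is absolutely
  continuous on bounded intervals. The point \<open>0\<close> is excluded: if \<open>t\<^sup>1\<^sup>-\<^sup>\<beta> \<rho>(t) \<rightarrow> x\<^sub>0\<close> as \<open>t \<rightarrow> 0\<close>, then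
  \<open>I\<^sup>1\<^sup>-\<^sup>\<beta>\<rho>(t) \<rightarrow> \<Gamma>(\<beta>) x\<^sub>0\<close>, whereas the integral over the empty interval is \<open>0\<close>, so \<open>I\<^sup>1\<^sup>-\<^sup>\<beta>\<rho>\<close> has to be
  read as its extension by the limit at \<open>0\<close>.
\<close>
definition RL_differentiable :: "real \<Rightarrow> (real \<Rightarrow> real) \<Rightarrow> bool" where
  "RL_differentiable \<beta> \<rho> \<longleftrightarrow>
     (\<forall>t>0. set_integrable lebesgue {0<..<t} (\<lambda>s. (t - s) powr (- \<beta>) * \<rho> s)) \<and>
     (\<forall>T>0. abs_continuous_on {0<..T} (RL_integral (1 - \<beta>) \<rho>))"

definition has_RL_derivative :: "real \<Rightarrow> (real \<Rightarrow> real) \<Rightarrow> real \<Rightarrow> real \<Rightarrow> bool" where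
  "has_RL_derivative \<beta> \<rho> d t \<longleftrightarrow>
     RL_differentiable \<beta> \<rho> \<and> (RL_integral (1 - \<beta>) \<rho> has_real_derivative d) (at t)"

definition C_plus :: "real \<Rightarrow> (real \<Rightarrow> real) set" where
  "C_plus \<alpha> = {x. continuous_on {0<..} x \<and> (\<forall>t>0. 0 \<le> x t) \<and>
     (\<exists>g. continuous_on {0..} g \<and> (\<forall>t\<ge>0. 0 \<le> g t) \<and> (\<forall>t>0. g t = t powr \<alpha> * x t))}"

definition is_solution ::
    "real \<Rightarrow> (real \<Rightarrow> real) \<Rightarrow> (real \<Rightarrow> real) \<Rightarrow> (real \<Rightarrow> real) \<Rightarrow> real \<Rightarrow> (real \<Rightarrow> real) \<Rightarrow> bool" where
  "is_solution \<beta> l \<phi> k x\<^sub>0 x \<longleftrightarrow>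
     (\<forall>t>0. has_RL_derivative \<beta> x (l t * \<phi> (x t) + k t) t) \<and>
     ((\<lambda>t. t powr (1 - \<beta>) * x t) \<longlongrightarrow> x\<^sub>0) (at_right 0)"

end

theory Submission
  imports Defs
begin

text \<open>
  Applying \<open>I\<^sup>\<beta>\<close> turns the problem into the Volterra equation
  \<open>x(t) = x\<^sub>0 t\<^sup>\<beta>\<^sup>-\<^sup>1 + 1/\<Gamma>(\<beta>) \<integral>\<^sub>0\<^sup>t (t - s)\<^sup>\<beta>\<^sup>-\<^sup>1 F(s) ds\<close> with \<open>F = l \<phi>(x) + k\<close>. Write \<open>F(s) = s\<^sup>-\<^sup>\<beta> H(s)\<close>
  and substitute \<open>s = t u\<close>: all powers of \<open>t\<close> cancel, and the integral becomes
  \<open>V H (t) = \<integral>\<^sub>0\<^sup>1 (1 - u)\<^sup>\<beta>\<^sup>-\<^sup>1 u\<^sup>-\<^sup>\<beta> H(t u) du\<close>. In this form it is evident that a nonincreasing \<open>H\<close>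
  gives a nonincreasing \<open>V H\<close> and that \<open>V H\<close> tends to \<open>0\<close> at infinity if \<open>H\<close> does. If \<open>x\<close> is
  nonincreasing, then so is \<open>H = t\<^sup>\<beta> l \<phi>(x) + t\<^sup>\<beta> k\<close>; hence the right-hand side of the Volterra equation
  maps nonincreasing functions to nonincreasing functions, and it is order preserving because \<open>\<phi>\<close> is
  nondecreasing.

  The integrability hypotheses enter only through a pointwise bound. For a function whose product with
  \<open>t\<^sup>\<beta>\<close> is nonincreasing, comparing the value at \<open>t\<close> with those on \<open>[t/2, t]\<close> turns membership in \<open>L\<^sup>p\<close>
  into a bound by \<open>t\<^sup>-\<^sup>1\<^sup>/\<^sup>p\<close> (\<open>Lp_antimono_pointwise_bound\<close>). With \<open>\<gamma> = \<beta> - 1/p > 0\<close>, a nonincreasing \<open>x\<close>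
  below \<open>A t\<^sup>\<beta>\<^sup>-\<^sup>1\<close> on \<open>(0, 1]\<close> then has \<open>F(t) \<le> (c\<^sub>1 A\<^sup>\<mu> + c\<^sub>2) t\<^sup>\<gamma>\<^sup>-\<^sup>1\<close> there, so that its image is again below
  \<open>A t\<^sup>\<beta>\<^sup>-\<^sup>1\<close> as soon as \<open>A\<close> is large, because \<open>\<mu> < 1\<close>. Beyond \<open>1\<close> monotonicity takes over. Iterating the
  map from \<open>0\<close> therefore gives an increasing and bounded sequence of nonincreasing functions; its limit
  is a fixed point by dominated convergence (\<open>fixed_point_exists\<close>).

  A fixed point \<open>x\<close> is strictly decreasing because \<open>x\<^sub>0 t\<^sup>\<beta>\<^sup>-\<^sup>1\<close> is, it tends to \<open>0\<close> because \<open>H\<close> does, and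
  the bound by \<open>t\<^sup>\<gamma>\<^sup>-\<^sup>1\<close> makes the integral term negligible against \<open>t\<^sup>\<beta>\<^sup>-\<^sup>1\<close> at \<open>0\<close>. Finally Tonelli and the Beta
  integral give \<open>I\<^sup>1\<^sup>-\<^sup>\<beta> x (t) = x\<^sub>0 \<Gamma>(\<beta>) + \<integral>\<^sub>0\<^sup>t F\<close> (\<open>RL_integral_of_Volterra\<close>). This is absolutely continuous
  because \<open>F\<close> is integrable at \<open>0\<close>, and has derivative \<open>F\<close> because \<open>F\<close> is continuous.
\<close>

section \<open>The scaled fractional integral of a nonincreasing function\<close>

text \<open>
  The two uses are \<open>r = \<beta> - 1\<close>, for candidate solutions, and \<open>r = \<beta> + \<gamma> - 1\<close>, for the functions \<open>H\<close> in the
  integrand. The growth bound is imposed on \<open>(0, 1]\<close> only: monotonicity propagates it to the right.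
\<close>
definition decay_profile :: "real \<Rightarrow> real \<Rightarrow> (real \<Rightarrow> real) \<Rightarrow> bool" where
  "decay_profile r C H \<longleftrightarrow> antimono_on {0<..} H \<and> (\<forall>t>0. 0 \<le> H t) \<and>
     (\<forall>t. 0 < t \<and> t \<le> 1 \<longrightarrow> H t \<le> C * t powr r)"

text \<open>
  This is \<open>\<integral>\<^sub>0\<^sup>t (t - s)\<^sup>\<beta>\<^sup>-\<^sup>1 s\<^sup>-\<^sup>\<beta> H(s) ds\<close> after the substitution \<open>s = t u\<close>. On the fixed interval \<open>(0, 1)\<close> the
  parameter \<open>t\<close> occurs in the argument of \<open>H\<close> alone, so that monotonicity and limits are inherited from \<open>H\<close>.
\<close>
definition scaled_integral :: "real \<Rightarrow> (real \<Rightarrow> real) \<Rightarrow> real \<Rightarrow> real" where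
  "scaled_integral \<beta> H t =
     (LINT u:{0<..<1}|lborel. (1 - u) powr (\<beta> - 1) * u powr (- \<beta>) * H (t * u))"

lemma antimono_on_Ioi_measurable:
  fixes H :: "real \<Rightarrow> real"
  assumes "antimono_on {0<..} H"
  shows "(\<lambda>s. indicator {0<..} s * H s) \<in> borel_measurable borel"
proof -
  have "mono_on {0<..} (\<lambda>s. - H s)"
    using assms by (auto simp: monotone_on_def)
  from borel_measurable_mono_on_fnc[OF this]
  have "(\<lambda>s. - H s) \<in> borel_measurable (restrict_space borel {0<..})" .
  then have "(\<lambda>s. - (- H s)) \<in> borel_measurable (restrict_space borel {0<..})"
    by (rule borel_measurable_uminus)
  then show ?thesis
    by (simp add: borel_measurable_restrict_space_iff mult.commute)
qed

lemma antimono_on_Ioi_measurable_scaled: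
  fixes H k :: "real \<Rightarrow> real"
  assumes "antimono_on {0<..} H" "0 < t" and [measurable]: "k \<in> borel_measurable borel"
  shows "(\<lambda>u. indicator {0<..<1} u * (k u * H (t * u))) \<in> borel_measurable borel"
proof -
  note antimono_on_Ioi_measurable[OF assms(1), measurable]
  have "(\<lambda>u. indicator {0<..<1} u * (k u * (indicator {0<..} (t * u) * H (t * u))))
      \<in> borel_measurable borel"
    by measurable
  also have "(\<lambda>u. indicator {0<..<1} u * (k u * (indicator {0<..} (t * u) * H (t * u))))
      = (\<lambda>u. indicator {0<..<1} u * (k u * H (t * u)))"
    using \<open>0 < t\<close> by (auto simp: fun_eq_iff indicator_def zero_less_mult_iff)
  finally show ?thesis .
qed

lemma Beta_set_integral:
  fixes a b :: real
  assumes "0 < a" "0 < b"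
  shows "set_integrable lborel {0<..<1} (\<lambda>u. u powr (a - 1) * (1 - u) powr (b - 1))"
    and "(LINT u:{0<..<1}|lborel. u powr (a - 1) * (1 - u) powr (b - 1)) = Beta a b"
proof -
  have i: "set_integrable lborel {0..1} (\<lambda>u. u powr (a - 1) * (1 - u) powr (b - 1))"
    by (rule integrable_Beta[OF assms])
  then show j: "set_integrable lborel {0<..<1} (\<lambda>u. u powr (a - 1) * (1 - u) powr (b - 1))"
    by (rule set_integrable_subset) auto
  have "((\<lambda>u. u powr (a - 1) * (1 - u) powr (b - 1)) has_integral Beta a b) {0<..<1}"
    using has_integral_Beta_real[OF assms] by (simp add: has_integral_Icc_iff_Ioo)
  then show "(LINT u:{0<..<1}|lborel. u powr (a - 1) * (1 - u) powr (b - 1)) = Beta a b"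
    using set_borel_integral_eq_integral(2)[OF j] by (simp add: integral_unique)
qed

text \<open>
  Since \<open>H\<close> is nonincreasing, \<open>t\<close> can be lowered to some \<open>c \<le> 1\<close>; then \<open>c u\<close> lies where the growth bound
  holds. The result is uniform in \<open>t \<ge> c\<close>.
\<close>
lemma decay_profile_scaled_bound:
  assumes H: "decay_profile (\<beta> + \<gamma> - 1) C H" and "0 < c" "c \<le> 1" "c \<le> t" "0 < u" "u < 1"
  shows "H (t * u) \<le> C * c powr (\<beta> + \<gamma> - 1) * u powr (\<beta> + \<gamma> - 1)"
proof -
  have "H (t * u) \<le> H (c * u)"
    using H assms by (auto simp: decay_profile_def monotone_on_def intro: mult_right_mono)
  also have "\<dots> \<le> C * (c * u) powr (\<beta> + \<gamma> - 1)"
    using H assms by (auto simp: decay_profile_def mult_le_one)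
  also have "\<dots> = C * c powr (\<beta> + \<gamma> - 1) * u powr (\<beta> + \<gamma> - 1)"
    using assms by (simp add: powr_mult)
  finally show ?thesis .
qed

text \<open>
  The integrable majorant for all dominated convergence arguments: the singularity \<open>u\<^sup>-\<^sup>\<beta>\<close> of the kernel
  and the growth of \<open>H\<close> combine to the Beta weight \<open>u\<^sup>\<gamma>\<^sup>-\<^sup>1 (1 - u)\<^sup>\<beta>\<^sup>-\<^sup>1\<close>.
\<close>
lemma decay_profile_kernel_bound:
  assumes H: "decay_profile (\<beta> + \<gamma> - 1) C H" and "0 < c" "c \<le> 1" "c \<le> t" "0 < u" "u < 1"
  shows "(1 - u) powr (\<beta> - 1) * u powr (- \<beta>) * H (t * u)
     \<le> C * c powr (\<beta> + \<gamma> - 1) * (u powr (\<gamma> - 1) * (1 - u) powr (\<beta> - 1))"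
proof -
  have "(1 - u) powr (\<beta> - 1) * u powr (- \<beta>) * H (t * u)
     \<le> (1 - u) powr (\<beta> - 1) * u powr (- \<beta>) * (C * c powr (\<beta> + \<gamma> - 1) * u powr (\<beta> + \<gamma> - 1))"
    by (intro mult_left_mono decay_profile_scaled_bound[OF assms]) auto
  also have "\<dots> = C * c powr (\<beta> + \<gamma> - 1) * ((u powr (- \<beta>) * u powr (\<beta> + \<gamma> - 1)) * (1 - u) powr (\<beta> - 1))"
    by (simp only: mult_ac)
  also have "u powr (- \<beta>) * u powr (\<beta> + \<gamma> - 1) = u powr (\<gamma> - 1)"
    by (simp add: powr_add[symmetric])
  finally show ?thesis .
qed

lemma scaled_integrable:
  assumes H: "decay_profile (\<beta> + \<gamma> - 1) C H" and "0 < \<beta>" "0 < \<gamma>" "0 < t"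
  shows "set_integrable lborel {0<..<1} (\<lambda>u. (1 - u) powr (\<beta> - 1) * u powr (- \<beta>) * H (t * u))"
proof -
  define c where "c = min t 1"
  have c: "0 < c" "c \<le> 1" "c \<le> t" using \<open>0 < t\<close> by (auto simp: c_def)
  let ?D = "C * c powr (\<beta> + \<gamma> - 1)"
  have D: "set_integrable lborel {0<..<1} (\<lambda>u. ?D * (u powr (\<gamma> - 1) * (1 - u) powr (\<beta> - 1)))"
    using Beta_set_integral(1)[OF \<open>0 < \<gamma>\<close> \<open>0 < \<beta>\<close>] by (rule set_integrable_mult_right)
  show ?thesis
    unfolding set_integrable_def
  proof (rule Bochner_Integration.integrable_bound[OF D[unfolded set_integrable_def]])
    have "antimono_on {0<..} H" using H by (auto simp: decay_profile_def)
    then show "(\<lambda>u. indicat_real {0<..<1} u *\<^sub>R ((1 - u) powr (\<beta> - 1) * u powr - \<beta> * H (t * u)))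
        \<in> borel_measurable lborel"
      using antimono_on_Ioi_measurable_scaled[of H t "\<lambda>u. (1 - u) powr (\<beta> - 1) * u powr (- \<beta>)"] \<open>0 < t\<close>
      unfolding real_scaleR_def measurable_lborel2 by measurable
    have "norm ((1 - u) powr (\<beta> - 1) * u powr - \<beta> * H (t * u))
        \<le> norm (?D * (u powr (\<gamma> - 1) * (1 - u) powr (\<beta> - 1)))" if "0 < u" "u < 1" for u
    proof -
      have "0 \<le> H (t * u)" using H that \<open>0 < t\<close> by (auto simp: decay_profile_def)
      then show ?thesis using decay_profile_kernel_bound[OF H c that] by simp
    qed
    then show "AE u in lborel. norm (indicat_real {0<..<1} u *\<^sub>R ((1 - u) powr (\<beta> - 1) * u powr - \<beta> * H (t * u)))
        \<le> norm (indicat_real {0<..<1} u *\<^sub>R (?D * (u powr (\<gamma> - 1) * (1 - u) powr (\<beta> - 1))))"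
      by (intro AE_I2) (simp add: indicator_def)
  qed
qed

text \<open>
  Function and argument may vary together. This one form of dominated convergence yields continuity in \<open>t\<close>
  (constant \<open>Hs\<close>), the limit at infinity (limit function \<open>0\<close>) and the passage to the limit along the
  monotone iteration (constant \<open>ts\<close>).
\<close>
lemma scaled_integral_tendsto:
  fixes ts :: "nat \<Rightarrow> real"
  assumes H: "decay_profile (\<beta> + \<gamma> - 1) C H" and Hs: "\<And>n. decay_profile (\<beta> + \<gamma> - 1) C (Hs n)"
    and b: "0 < \<beta>" "0 < \<gamma>" and c: "0 < c" "c \<le> 1" and ts: "\<And>n. c \<le> ts n" and t: "0 < t"
    and lim: "AE u in lborel. 0 < u \<and> u < 1 \<longrightarrow> (\<lambda>n. Hs n (ts n * u)) \<longlonglongrightarrow> H (t * u)"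
  shows "(\<lambda>n. scaled_integral \<beta> (Hs n) (ts n)) \<longlonglongrightarrow> scaled_integral \<beta> H t"
  unfolding scaled_integral_def set_lebesgue_integral_def
proof (rule integral_dominated_convergence)
  let ?D = "C * c powr (\<beta> + \<gamma> - 1)"
  let ?w = "\<lambda>u. indicat_real {0<..<1} u *\<^sub>R (?D * (u powr (\<gamma> - 1) * (1 - u) powr (\<beta> - 1)))"
  have pos: "0 < ts n" for n using ts[of n] c by simp
  show "integrable lborel ?w"
    using set_integrable_mult_right[OF Beta_set_integral(1)[OF b(2,1)], of ?D]
    by (simp add: set_integrable_def)
  show "(\<lambda>u. indicat_real {0<..<1} u *\<^sub>R ((1 - u) powr (\<beta> - 1) * u powr - \<beta> * H (t * u)))
        \<in> borel_measurable lborel"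
    using scaled_integrable[OF H b t] by (auto simp: set_integrable_def)
  show "(\<lambda>u. indicat_real {0<..<1} u *\<^sub>R ((1 - u) powr (\<beta> - 1) * u powr - \<beta> * Hs n (ts n * u)))
        \<in> borel_measurable lborel" for n
    using scaled_integrable[OF Hs b pos] by (auto simp: set_integrable_def)
  show "AE u in lborel. (\<lambda>n. indicat_real {0<..<1} u *\<^sub>R ((1 - u) powr (\<beta> - 1) * u powr - \<beta> * Hs n (ts n * u)))
      \<longlonglongrightarrow> indicat_real {0<..<1} u *\<^sub>R ((1 - u) powr (\<beta> - 1) * u powr - \<beta> * H (t * u))"
    using lim by eventually_elim (auto simp: indicator_def intro!: tendsto_intros)
  have "norm ((1 - u) powr (\<beta> - 1) * u powr - \<beta> * Hs n (ts n * u))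
      \<le> ?D * (u powr (\<gamma> - 1) * (1 - u) powr (\<beta> - 1))" if "0 < u" "u < 1" for u n
  proof -
    have "0 \<le> Hs n (ts n * u)" using Hs[of n] that pos[of n] by (auto simp: decay_profile_def)
    then show ?thesis using decay_profile_kernel_bound[OF Hs c ts that, of n] by simp
  qed
  then show "AE u in lborel. norm (indicat_real {0<..<1} u *\<^sub>R ((1 - u) powr (\<beta> - 1) * u powr - \<beta> * Hs n (ts n * u)))
        \<le> ?w u" for n
    by (intro AE_I2) (simp add: indicator_def)
qed

lemma scaled_integral_mono:
  assumes "decay_profile (\<beta> + \<gamma> - 1) C H" "decay_profile (\<beta> + \<gamma> - 1) C' G" "0 < \<beta>" "0 < \<gamma>" "0 < s" "0 < t"
    and "\<And>u. 0 < u \<Longrightarrow> u < 1 \<Longrightarrow> H (s * u) \<le> G (t * u)"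
  shows "scaled_integral \<beta> H s \<le> scaled_integral \<beta> G t"
  unfolding scaled_integral_def
  using assms(7)
  by (intro set_integral_mono scaled_integrable[OF assms(1,3,4,5)] scaled_integrable[OF assms(2,3,4,6)])
    (auto intro!: mult_left_mono)

lemma scaled_integral_nonneg:
  assumes "decay_profile (\<beta> + \<gamma> - 1) C H" "0 < t"
  shows "0 \<le> scaled_integral \<beta> H t"
  unfolding scaled_integral_def set_lebesgue_integral_def
  using assms by (intro Bochner_Integration.integral_nonneg) (auto simp: decay_profile_def indicator_def)

lemma scaled_integral_antimono:
  assumes H: "decay_profile (\<beta> + \<gamma> - 1) C H" and "0 < \<beta>" "0 < \<gamma>"
  shows "antimono_on {0<..} (scaled_integral \<beta> H)"
proof (rule monotone_onI)
  fix s t :: real assume st: "s \<in> {0<..}" "t \<in> {0<..}" "s \<le> t"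
  show "scaled_integral \<beta> H t \<le> scaled_integral \<beta> H s"
  proof (rule scaled_integral_mono[OF H H])
    fix u :: real assume "0 < u" "u < 1"
    then show "H (t * u) \<le> H (s * u)"
      using H st by (auto simp: decay_profile_def monotone_on_def)
  qed (use st assms in auto)
qed

lemma scaled_integral_bound:
  assumes H: "decay_profile (\<beta> + \<gamma> - 1) C H" and b: "0 < \<beta>" "0 < \<gamma>" and t: "0 < t" "t \<le> 1"
  shows "scaled_integral \<beta> H t \<le> C * Beta \<gamma> \<beta> * t powr (\<beta> + \<gamma> - 1)"
proof -
  let ?D = "C * t powr (\<beta> + \<gamma> - 1)"
  note i = Beta_set_integral[OF b(2,1)]
  have "scaled_integral \<beta> H t \<le> (LINT u:{0<..<1}|lborel. ?D * (u powr (\<gamma> - 1) * (1 - u) powr (\<beta> - 1)))"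
    unfolding scaled_integral_def
    by (intro set_integral_mono scaled_integrable[OF H b t(1)] set_integrable_mult_right[OF i(1)]
        decay_profile_kernel_bound[OF H t]) auto
  also have "\<dots> = ?D * Beta \<gamma> \<beta>"
    using i by simp
  finally show ?thesis by (simp add: mult_ac)
qed

text \<open>
  Continuity of \<open>H\<close> is not assumed, since limits of the iteration are at first only known to be monotone.
  A monotone function has countably many jumps, so for fixed \<open>t\<close> almost every \<open>u\<close> makes \<open>t u\<close> a point of
  continuity of \<open>H\<close>, which is enough for dominated convergence.
\<close>
lemma scaled_integral_continuous:
  assumes H: "decay_profile (\<beta> + \<gamma> - 1) C H" and b: "0 < \<beta>" "0 < \<gamma>"
  shows "continuous_on {0<..} (scaled_integral \<beta> H)"
proof (rule continuous_on_sequentiallyI)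
  fix ts :: "nat \<Rightarrow> real" and t :: real
  assume "t \<in> {0<..}" and ts: "\<forall>n. ts n \<in> {0<..}" and lim: "ts \<longlonglongrightarrow> t"
  then have t: "0 < t" by simp
  \<comment> \<open>A lower bound for all but finitely many \<open>ts n\<close>, as the majorant requires.\<close>
  define c where "c = min (t / 2) 1"
  have c: "0 < c" "c \<le> 1" "c < t" using t by (auto simp: c_def)
  obtain N where N: "\<And>n. N \<le> n \<Longrightarrow> c < ts n"
    using order_tendstoD(1)[OF lim c(3)] by (auto simp: eventually_sequentially)
  \<comment> \<open>The discontinuities of \<open>H\<close> are those of the nondecreasing function \<open>- H\<close>, hence countable.\<close>
  define D where "D = {a \<in> {0<..}. \<not> isCont (\<lambda>s. - H s) a}"
  have "countable D"
    unfolding D_def using H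
    by (intro mono_on_ctble_discont_open) (auto simp: decay_profile_def monotone_on_def)
  then have "countable ((\<lambda>d. d / t) ` D)" by simp
  then have "AE u in lborel. u \<notin> (\<lambda>d. d / t) ` D"
    by (intro AE_not_in) (simp add: countable_imp_null_set_lborel)
  then have ae: "AE u in lborel. 0 < u \<and> u < 1 \<longrightarrow> (\<lambda>n. H (ts (n + N) * u)) \<longlonglongrightarrow> H (t * u)"
  proof eventually_elim
    case (elim u)
    show ?case
    proof
      assume u: "0 < u \<and> u < 1"
      have "t * u \<notin> D"
      proof
        assume "t * u \<in> D"
        then have "t * u / t \<in> (\<lambda>d. d / t) ` D" by (rule imageI)
        with elim t show False by simp
      qed
      then have "isCont (\<lambda>s. - H s) (t * u)"
        using t u by (auto simp: D_def)
      from isCont_minus[OF this] have "isCont H (t * u)" by simp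
      moreover have "(\<lambda>n. ts (n + N) * u) \<longlonglongrightarrow> t * u"
        using LIMSEQ_ignore_initial_segment[OF lim] by (intro tendsto_intros)
      ultimately show "(\<lambda>n. H (ts (n + N) * u)) \<longlonglongrightarrow> H (t * u)"
        by (rule isCont_tendsto_compose)
    qed
  qed
  have "(\<lambda>n. scaled_integral \<beta> H (ts (n + N))) \<longlonglongrightarrow> scaled_integral \<beta> H t"
    by (rule scaled_integral_tendsto[OF H H b c(1,2) _ t ae]) (use N in \<open>auto intro: less_imp_le\<close>)
  then show "(\<lambda>n. scaled_integral \<beta> H (ts n)) \<longlonglongrightarrow> scaled_integral \<beta> H t"
    by (rule LIMSEQ_offset)
qed

lemma scaled_integral_at_top:
  assumes H: "decay_profile (\<beta> + \<gamma> - 1) C H" and b: "0 < \<beta>" "0 < \<gamma>" and "0 \<le> C"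
    and lim: "(H \<longlongrightarrow> 0) at_top"
  shows "(scaled_integral \<beta> H \<longlongrightarrow> 0) at_top"
proof (rule tendsto_at_topI_sequentially)
  fix ts :: "nat \<Rightarrow> real" assume ts: "filterlim ts at_top sequentially"
  then obtain N where N: "\<And>n. N \<le> n \<Longrightarrow> 1 \<le> ts n"
    by (auto simp: filterlim_at_top eventually_sequentially)
  have Z: "decay_profile (\<beta> + \<gamma> - 1) C (\<lambda>_. 0)"
    using \<open>0 \<le> C\<close> by (auto simp: decay_profile_def monotone_on_def)
  have ts': "filterlim (\<lambda>n. ts (n + N)) at_top sequentially"
    by (rule filterlim_compose[OF ts filterlim_add_const_nat_at_top])
  have "(\<lambda>n. H (ts (n + N) * u)) \<longlonglongrightarrow> 0" if "0 < u" for u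
    using filterlim_at_top_mult_tendsto_pos[OF tendsto_const that ts']
    by (intro filterlim_compose[OF lim]) (simp add: mult.commute)
  then have "(\<lambda>n. scaled_integral \<beta> H (ts (n + N))) \<longlonglongrightarrow> scaled_integral \<beta> (\<lambda>_. 0) 1"
    by (intro scaled_integral_tendsto[OF Z H b, of 1]) (use N in auto)
  also have "scaled_integral \<beta> (\<lambda>_. 0) 1 = 0" by (simp add: scaled_integral_def set_lebesgue_integral_def)
  finally show "(\<lambda>n. scaled_integral \<beta> H (ts n)) \<longlonglongrightarrow> 0"
    by (rule LIMSEQ_offset)
qed

section \<open>Composition of the two Abel kernels\<close>

lemma nn_integral_Beta_affine:
  fixes a b r t :: real
  assumes "0 < a" "0 < b" "r < t"
  shows "(\<integral>\<^sup>+s. ennreal (indicator {r<..<t} s * ((t - s) powr (a - 1) * (s - r) powr (b - 1))) \<partial>lborel)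
    = ennreal ((t - r) powr (a + b - 1) * Beta a b)"
proof -
  note i = Beta_set_integral[OF assms(2,1)]
  have B: "(\<integral>\<^sup>+x. ennreal (indicator {0<..<1} x * (x powr (b - 1) * (1 - x) powr (a - 1))) \<partial>lborel)
      = ennreal (Beta a b)"
    using i nn_integral_eq_integral[of lborel "\<lambda>x. indicator {0<..<1} x * (x powr (b - 1) * (1 - x) powr (a - 1))"]
    by (simp add: set_integrable_def set_lebesgue_integral_def Beta_commute)
  have e: "indicator {r<..<t} (r + (t - r) * x) * ((t - (r + (t - r) * x)) powr (a - 1) * (r + (t - r) * x - r) powr (b - 1))
      = (t - r) powr (a + b - 2) * (indicator {0<..<1} x * (x powr (b - 1) * (1 - x) powr (a - 1)))" for x
  proof -
    have c: "r + (t - r) * x \<in> {r<..<t} \<longleftrightarrow> x \<in> {0<..<1}"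
    proof -
      have "r + (t - r) * x < t \<longleftrightarrow> (t - r) * x < (t - r) * 1" by auto
      also have "\<dots> \<longleftrightarrow> x < 1" using assms(3) by (subst mult_less_cancel_left_pos) auto
      finally show ?thesis using assms(3) by (simp add: zero_less_mult_iff)
    qed
    have d: "t - (r + (t - r) * x) = (t - r) * (1 - x)" by (simp add: algebra_simps)
    show ?thesis
    proof (cases "x \<in> {0<..<1}")
      case True
      have "(t - r) powr (a - 1) * (t - r) powr (b - 1) = (t - r) powr (a + b - 2)"
        using assms(3) by (simp add: powr_add[symmetric])
      then show ?thesis
        using True c assms(3) by (simp add: d powr_mult)
    next
      case False
      then show ?thesis using c by (simp add: indicator_def)
    qed
  qed
  have "(\<integral>\<^sup>+s. ennreal (indicator {r<..<t} s * ((t - s) powr (a - 1) * (s - r) powr (b - 1))) \<partial>lborel)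
    = ennreal (t - r) * (\<integral>\<^sup>+x. ennreal ((t - r) powr (a + b - 2)) * ennreal (indicator {0<..<1} x * (x powr (b - 1) * (1 - x) powr (a - 1))) \<partial>lborel)"
    using assms(3) nn_integral_real_affine[where c = "t - r" and t = r,
        of "\<lambda>s. ennreal (indicator {r<..<t} s * ((t - s) powr (a - 1) * (s - r) powr (b - 1)))"]
    unfolding e by (simp add: ennreal_mult'[OF powr_ge_zero])
  also have "\<dots> = ennreal (t - r) * (ennreal ((t - r) powr (a + b - 2)) * ennreal (Beta a b))"
    by (subst nn_integral_cmult) (simp_all add: B)
  also have "\<dots> = ennreal (((t - r) * (t - r) powr (a + b - 2)) * Beta a b)"
    using assms(3) by (simp add: ennreal_mult' mult.assoc)
  also have "(t - r) * (t - r) powr (a + b - 2) = (t - r) powr (a + b - 1)"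
    using assms(3) powr_mult_base[of "t - r" "a + b - 2"] by (simp add: algebra_simps)
  finally show ?thesis .
qed

text \<open>
  The semigroup law \<open>I\<^sup>1\<^sup>-\<^sup>\<beta> I\<^sup>\<beta> = I\<^sup>1\<close> without the Gamma factors. By Tonelli the inner integral over
  \<open>s \<in> (r, t)\<close> of the product of the two kernels can be taken first; its exponents add up to \<open>-1\<close>, so it is a
  constant. Values in \<open>ennreal\<close> avoid any integrability question.
\<close>
lemma Abel_kernel_composition:
  fixes f :: "real \<Rightarrow> ennreal"
  assumes [measurable]: "f \<in> borel_measurable borel" and "0 < \<beta>" "\<beta> < 1"
  shows "(\<integral>\<^sup>+s. ennreal (indicator {0<..<t} s * (t - s) powr (- \<beta>)) *
            (\<integral>\<^sup>+r. ennreal (indicator {0<..<s} r * (s - r) powr (\<beta> - 1)) * f r \<partial>lborel) \<partial>lborel)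
    = ennreal (Beta (1 - \<beta>) \<beta>) * (\<integral>\<^sup>+r. indicator {0<..<t} r * f r \<partial>lborel)"
proof -
  \<comment> \<open>Together with the indicator of \<open>(0, t)\<close> in \<open>?g\<close> this describes the triangle \<open>0 < r < s < t\<close>.\<close>
  let ?K = "\<lambda>s r. ennreal (if r < s \<and> s < t then (t - s) powr (- \<beta>) * (s - r) powr (\<beta> - 1) else 0)"
  let ?g = "\<lambda>s r. ?K s r * (indicator {0<..<t} r * f r)"
  have "(\<integral>\<^sup>+s. ennreal (indicator {0<..<t} s * (t - s) powr (- \<beta>)) *
            (\<integral>\<^sup>+r. ennreal (indicator {0<..<s} r * (s - r) powr (\<beta> - 1)) * f r \<partial>lborel) \<partial>lborel)
      = (\<integral>\<^sup>+s. (\<integral>\<^sup>+r. ?g s r \<partial>lborel) \<partial>lborel)"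
  proof (rule nn_integral_cong)
    fix s
    have "ennreal (indicator {0<..<t} s * (t - s) powr (- \<beta>)) *
            (\<integral>\<^sup>+r. ennreal (indicator {0<..<s} r * (s - r) powr (\<beta> - 1)) * f r \<partial>lborel)
        = (\<integral>\<^sup>+r. ennreal (indicator {0<..<t} s * (t - s) powr (- \<beta>)) *
            (ennreal (indicator {0<..<s} r * (s - r) powr (\<beta> - 1)) * f r) \<partial>lborel)"
      by (rule nn_integral_cmult[symmetric]) measurable
    also have "\<dots> = (\<integral>\<^sup>+r. ?g s r \<partial>lborel)"
      by (intro nn_integral_cong) (auto simp: indicator_def ennreal_mult' mult.assoc)
    finally show "ennreal (indicator {0<..<t} s * (t - s) powr (- \<beta>)) *
            (\<integral>\<^sup>+r. ennreal (indicator {0<..<s} r * (s - r) powr (\<beta> - 1)) * f r \<partial>lborel)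
        = (\<integral>\<^sup>+r. ?g s r \<partial>lborel)" .
  qed
  also have "\<dots> = (\<integral>\<^sup>+r. (\<integral>\<^sup>+s. ?g s r \<partial>lborel) \<partial>lborel)"
    by (rule lborel_pair.Fubini') measurable
  also have "\<dots> = (\<integral>\<^sup>+r. ennreal (Beta (1 - \<beta>) \<beta>) * (indicator {0<..<t} r * f r) \<partial>lborel)"
  proof (rule nn_integral_cong)
    fix r
    have "(\<integral>\<^sup>+s. ?g s r \<partial>lborel) = (\<integral>\<^sup>+s. ?K s r \<partial>lborel) * (indicator {0<..<t} r * f r)"
      by (rule nn_integral_multc) measurable
    also have "\<dots> = ennreal (Beta (1 - \<beta>) \<beta>) * (indicator {0<..<t} r * f r)"
    proof (cases "r \<in> {0<..<t}")
      case True
      have "(\<integral>\<^sup>+s. ?K s r \<partial>lborel) =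
          (\<integral>\<^sup>+s. ennreal (indicator {r<..<t} s * ((t - s) powr (1 - \<beta> - 1) * (s - r) powr (\<beta> - 1))) \<partial>lborel)"
        by (intro nn_integral_cong) (auto simp: indicator_def)
      also have "\<dots> = ennreal (Beta (1 - \<beta>) \<beta>)"
        using True assms by (subst nn_integral_Beta_affine) auto
      finally show ?thesis by simp
    qed simp
    finally show "(\<integral>\<^sup>+s. ?g s r \<partial>lborel) = ennreal (Beta (1 - \<beta>) \<beta>) * (indicator {0<..<t} r * f r)" .
  qed
  also have "\<dots> = ennreal (Beta (1 - \<beta>) \<beta>) * (\<integral>\<^sup>+r. indicator {0<..<t} r * f r \<partial>lborel)"
    by (rule nn_integral_cmult) measurable
  finally show ?thesis .
qed

lemma weighted_profile_measurable:
  fixes H :: "real \<Rightarrow> real"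
  assumes "antimono_on {0<..} H"
  shows "(\<lambda>s. indicator {0<..} s * (s powr (- \<beta>) * H s)) \<in> borel_measurable borel"
proof -
  note antimono_on_Ioi_measurable[OF assms, measurable]
  have "(\<lambda>s. s powr (- \<beta>) * (indicator {0<..} s * H s)) \<in> borel_measurable borel"
    by measurable
  then show ?thesis by (simp add: mult_ac)
qed

lemma scaled_integral_eq_convolution:
  assumes H: "decay_profile (\<beta> + \<gamma> - 1) C H" and b: "0 < \<beta>" "0 < \<gamma>" and t: "0 < t"
  shows "(\<integral>\<^sup>+r. ennreal (indicator {0<..<t} r * (t - r) powr (\<beta> - 1)) *
            ennreal (indicator {0<..} r * (r powr (- \<beta>) * H r)) \<partial>lborel)
    = ennreal (scaled_integral \<beta> H t)"
proof -
  have anti: "antimono_on {0<..} H" using H by (simp add: decay_profile_def)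
  note [measurable] = weighted_profile_measurable[OF anti, of \<beta>]
  let ?k = "\<lambda>u. (1 - u) powr (\<beta> - 1) * u powr (- \<beta>) * H (t * u)"
  have nonneg: "0 \<le> indicator {0<..<1} u * ?k u" for u
    using H t by (auto simp: decay_profile_def indicator_def)
  have e: "ennreal t * (ennreal (indicator {0<..<t} (0 + t * u) * (t - (0 + t * u)) powr (\<beta> - 1)) *
            ennreal (indicator {0<..} (0 + t * u) * ((0 + t * u) powr (- \<beta>) * H (0 + t * u))))
      = ennreal (indicator {0<..<1} u * ?k u)" for u
  proof (cases "u \<in> {0<..<1}")
    case True
    have d: "t - t * u = t * (1 - u)" by (simp add: algebra_simps)
    have 0: "0 \<le> H (t * u)" using H True t by (auto simp: decay_profile_def)
    have "t * t powr (\<beta> - 1) * t powr (- \<beta>) = 1"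
      using t by (simp add: powr_mult_base powr_add[symmetric])
    then have "t * ((t * (1 - u)) powr (\<beta> - 1) * ((t * u) powr (- \<beta>) * H (t * u))) = ?k u"
      using True t by (simp add: powr_mult)
    then show ?thesis
      using True t 0 by (simp add: d ennreal_mult'[symmetric])
  next
    case False
    have "t * u < t \<longleftrightarrow> u < 1" using t mult_less_cancel_left_pos[of t u 1] by simp
    with False t show ?thesis by (auto simp: indicator_def zero_less_mult_iff)
  qed
  have "(\<integral>\<^sup>+r. ennreal (indicator {0<..<t} r * (t - r) powr (\<beta> - 1)) *
            ennreal (indicator {0<..} r * (r powr (- \<beta>) * H r)) \<partial>lborel)
      = (\<integral>\<^sup>+u. ennreal t * (ennreal (indicator {0<..<t} (0 + t * u) * (t - (0 + t * u)) powr (\<beta> - 1)) *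
            ennreal (indicator {0<..} (0 + t * u) * ((0 + t * u) powr (- \<beta>) * H (0 + t * u)))) \<partial>lborel)"
    using t by (subst nn_integral_real_affine[where c = t and t = 0]) (simp_all add: nn_integral_cmult)
  also have "\<dots> = (\<integral>\<^sup>+u. ennreal (indicator {0<..<1} u * ?k u) \<partial>lborel)"
    by (simp only: e)
  also have "\<dots> = ennreal (scaled_integral \<beta> H t)"
    using scaled_integrable[OF H b t] nonneg
    unfolding scaled_integral_def set_lebesgue_integral_def set_integrable_def
    by (subst nn_integral_eq_integral) auto
  finally show ?thesis .
qed

text \<open>
  On \<open>(0, t)\<close> the kernel \<open>(t - r)\<^sup>\<beta>\<^sup>-\<^sup>1\<close> is at least \<open>t\<^sup>\<beta>\<^sup>-\<^sup>1\<close>, so finiteness of the scaled integral already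
  forces integrability of its density.
\<close>
lemma decay_profile_weighted_integrable:
  assumes H: "decay_profile (\<beta> + \<gamma> - 1) C H" and b: "0 < \<beta>" "\<beta> < 1" "0 < \<gamma>" and t: "0 < t"
  shows "set_integrable lborel {0<..<t} (\<lambda>s. s powr (- \<beta>) * H s)"
proof -
  have anti: "antimono_on {0<..} H" using H by (simp add: decay_profile_def)
  note [measurable] = weighted_profile_measurable[OF anti, of \<beta>]
  let ?F = "\<lambda>r. indicator {0<..} r * (r powr (- \<beta>) * H r)"
  have "(\<integral>\<^sup>+r. ennreal (indicator {0<..<t} r * ?F r) \<partial>lborel)
      \<le> (\<integral>\<^sup>+r. ennreal (t powr (1 - \<beta>)) * (ennreal (indicator {0<..<t} r * (t - r) powr (\<beta> - 1)) * ennreal (?F r)) \<partial>lborel)"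
  proof (rule nn_integral_mono)
    fix r
    show "ennreal (indicator {0<..<t} r * ?F r)
        \<le> ennreal (t powr (1 - \<beta>)) * (ennreal (indicator {0<..<t} r * (t - r) powr (\<beta> - 1)) * ennreal (?F r))"
    proof (cases "r \<in> {0<..<t}")
      case True
      have 0: "0 \<le> r powr (- \<beta>) * H r" using H True by (auto simp: decay_profile_def)
      have "t powr (\<beta> - 1) \<le> (t - r) powr (\<beta> - 1)"
        using True b by (intro powr_mono2') auto
      then have "t powr (1 - \<beta>) * t powr (\<beta> - 1) \<le> t powr (1 - \<beta>) * (t - r) powr (\<beta> - 1)"
        by (intro mult_left_mono) auto
      then have "1 \<le> t powr (1 - \<beta>) * (t - r) powr (\<beta> - 1)"
        using t by (simp add: powr_add[symmetric])
      from mult_right_mono[OF this 0]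
      have "r powr (- \<beta>) * H r \<le> t powr (1 - \<beta>) * ((t - r) powr (\<beta> - 1) * (r powr (- \<beta>) * H r))"
        by (simp only: mult_1 mult.assoc)
      then show ?thesis
        using True 0 by (simp add: ennreal_mult'[symmetric] ennreal_leI)
    qed simp
  qed
  also have "\<dots> = ennreal (t powr (1 - \<beta>)) * ennreal (scaled_integral \<beta> H t)"
    by (subst nn_integral_cmult) (simp_all add: scaled_integral_eq_convolution[OF H b(1,3) t])
  also have "\<dots> < \<infinity>" by (simp add: ennreal_mult_less_top)
  finally have "integrable lborel (\<lambda>r. indicator {0<..<t} r * ?F r)"
    using H by (intro integrableI_nonneg) (measurable, auto simp: decay_profile_def indicator_def)
  also have "(\<lambda>r. indicator {0<..<t} r * ?F r) = (\<lambda>r. indicator {0<..<t} r * (r powr (- \<beta>) * H r))"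
    by (auto simp: indicator_def)
  finally show ?thesis by (simp add: set_integrable_def)
qed

text \<open>
  The free term \<open>x\<^sub>0 s\<^sup>\<beta>\<^sup>-\<^sup>1\<close> contributes the Beta integral \<open>\<Gamma>(\<beta>) \<Gamma>(1 - \<beta>)\<close>, and the integral term contributes
  the same constant times \<open>\<integral>\<^sub>0\<^sup>t s\<^sup>-\<^sup>\<beta> H(s) ds\<close>. Everything is nonnegative, so the computation with
  nonnegative integrals also gives the integrability.
\<close>
lemma RL_integral_of_Volterra:
  assumes H: "decay_profile (\<beta> + \<gamma> - 1) C H" and b: "0 < \<beta>" "\<beta> < 1" "0 < \<gamma>" and "0 \<le> x\<^sub>0" and t: "0 < t"
    and x: "\<And>s. 0 < s \<Longrightarrow> x s = x\<^sub>0 * s powr (\<beta> - 1) + scaled_integral \<beta> H s / Gamma \<beta>"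
  shows "set_integrable lebesgue {0<..<t} (\<lambda>s. (t - s) powr (- \<beta>) * x s)"
    and "RL_integral (1 - \<beta>) x t = x\<^sub>0 * Gamma \<beta> + (LINT s:{0<..<t}|lborel. s powr (- \<beta>) * H s)"
proof -
  have anti: "antimono_on {0<..} H" using H by (simp add: decay_profile_def)
  note [measurable] = weighted_profile_measurable[OF anti, of \<beta>]
    antimono_on_Ioi_measurable[OF scaled_integral_antimono[OF H b(1,3)]]
  let ?V = "scaled_integral \<beta> H"
  let ?F = "\<lambda>r. indicator {0<..} r * (r powr (- \<beta>) * H r)"
  let ?B = "Beta (1 - \<beta>) \<beta>"
  define J where "J = (LINT s:{0<..<t}|lborel. s powr (- \<beta>) * H s)"
  have G: "0 < Gamma \<beta>" "0 < Gamma (1 - \<beta>)" using b by (auto intro: Gamma_real_pos)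
  have B: "?B = Gamma \<beta> * Gamma (1 - \<beta>)"
    by (simp add: Beta_def)
  have V0: "0 \<le> ?V s" if "0 < s" for s
    by (rule scaled_integral_nonneg[OF H that])
  have J: "(\<integral>\<^sup>+r. indicator {0<..<t} r * ennreal (?F r) \<partial>lborel) = ennreal J"
  proof -
    have "(\<integral>\<^sup>+r. indicator {0<..<t} r * ennreal (?F r) \<partial>lborel)
       = (\<integral>\<^sup>+r. ennreal (indicator {0<..<t} r * (r powr (- \<beta>) * H r)) \<partial>lborel)"
      by (intro nn_integral_cong) (auto simp: indicator_def)
    also have "\<dots> = ennreal J"
      using decay_profile_weighted_integrable[OF H b t] H
      unfolding J_def set_lebesgue_integral_def set_integrable_def
      by (subst nn_integral_eq_integral) (auto simp: decay_profile_def indicator_def)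
    finally show ?thesis .
  qed
  have J0: "0 \<le> J"
    using H unfolding J_def set_lebesgue_integral_def
    by (intro Bochner_Integration.integral_nonneg) (auto simp: decay_profile_def indicator_def)
  let ?h = "\<lambda>s. indicator {0<..<t} s * ((t - s) powr (- \<beta>) * x s)"
  let ?h1 = "\<lambda>s. indicator {0<..<t} s * ((t - s) powr (1 - \<beta> - 1) * (s - 0) powr (\<beta> - 1))"
  let ?h2 = "\<lambda>s. indicator {0<..<t} s * (t - s) powr (- \<beta>) * (indicator {0<..} s * ?V s)"
  have h: "?h s = x\<^sub>0 * ?h1 s + 1 / Gamma \<beta> * ?h2 s" for s
    by (auto simp: indicator_def x algebra_simps)
  have m: "?h \<in> borel_measurable borel"
    unfolding h by measurable
  have n1: "(\<integral>\<^sup>+s. ennreal (?h1 s) \<partial>lborel) = ennreal ?B"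
    using t b by (subst nn_integral_Beta_affine) auto
  have n2: "(\<integral>\<^sup>+s. ennreal (?h2 s) \<partial>lborel) = ennreal (?B * J)"
  proof -
    have "(\<integral>\<^sup>+s. ennreal (?h2 s) \<partial>lborel) =
       (\<integral>\<^sup>+s. ennreal (indicator {0<..<t} s * (t - s) powr (- \<beta>)) *
            (\<integral>\<^sup>+r. ennreal (indicator {0<..<s} r * (s - r) powr (\<beta> - 1)) * ennreal (?F r) \<partial>lborel) \<partial>lborel)"
    proof (rule nn_integral_cong)
      fix s
      show "ennreal (?h2 s) = ennreal (indicator {0<..<t} s * (t - s) powr (- \<beta>)) *
            (\<integral>\<^sup>+r. ennreal (indicator {0<..<s} r * (s - r) powr (\<beta> - 1)) * ennreal (?F r) \<partial>lborel)"
      proof (cases "s \<in> {0<..<t}")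
        case True
        then show ?thesis
          using V0[of s] by (subst scaled_integral_eq_convolution[OF H b(1,3)]) (auto simp: ennreal_mult')
      qed simp
    qed
    also have "\<dots> = ennreal ?B * ennreal J"
      by (subst Abel_kernel_composition) (use b J in auto)
    finally show ?thesis using J0 by (simp add: ennreal_mult'')
  qed
  have "(\<integral>\<^sup>+s. ennreal (?h s) \<partial>lborel)
      = (\<integral>\<^sup>+s. ennreal x\<^sub>0 * ennreal (?h1 s) + ennreal (1 / Gamma \<beta>) * ennreal (?h2 s) \<partial>lborel)"
    unfolding h using G V0 \<open>0 \<le> x\<^sub>0\<close>
    by (intro nn_integral_cong) (auto simp: indicator_def ennreal_plus[symmetric] ennreal_mult'[symmetric] simp del: ennreal_plus)
  also have "\<dots> = ennreal x\<^sub>0 * ennreal ?B + ennreal (1 / Gamma \<beta>) * ennreal (?B * J)"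
    by (simp add: nn_integral_add nn_integral_cmult n1[simplified] n2[simplified])
  also have "\<dots> = ennreal (x\<^sub>0 * ?B + 1 / Gamma \<beta> * (?B * J))"
    using G J0 \<open>0 \<le> x\<^sub>0\<close> by (simp add: B ennreal_plus[symmetric] ennreal_mult'[symmetric] del: ennreal_plus)
  finally have nn: "(\<integral>\<^sup>+s. ennreal (?h s) \<partial>lborel) = ennreal (x\<^sub>0 * ?B + 1 / Gamma \<beta> * (?B * J))" .
  have hb: "has_bochner_integral lborel ?h (x\<^sub>0 * ?B + 1 / Gamma \<beta> * (?B * J))"
  proof (rule has_bochner_integral_nn_integral[OF _ _ _ nn])
    show "?h \<in> borel_measurable lborel" using m by simp
    show "AE s in lborel. 0 \<le> ?h s"
      unfolding h using G V0 \<open>0 \<le> x\<^sub>0\<close> by (intro AE_I2) (auto simp: indicator_def)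
    show "0 \<le> x\<^sub>0 * ?B + 1 / Gamma \<beta> * (?B * J)" using G J0 \<open>0 \<le> x\<^sub>0\<close> by (simp add: B)
  qed
  then show "set_integrable lebesgue {0<..<t} (\<lambda>s. (t - s) powr (- \<beta>) * x s)"
    using m by (simp add: set_integrable_def integrable_completion has_bochner_integral_iff)
  have "(LINT s:{0<..<t}|lebesgue. (t - s) powr (- \<beta>) * x s) = x\<^sub>0 * ?B + 1 / Gamma \<beta> * (?B * J)"
    using hb m by (simp add: set_lebesgue_integral_def integral_completion has_bochner_integral_iff)
  then show "RL_integral (1 - \<beta>) x t = x\<^sub>0 * Gamma \<beta> + (LINT s:{0<..<t}|lborel. s powr (- \<beta>) * H s)"
    using G unfolding RL_integral_def J_def[symmetric] by (simp add: B field_simps)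
qed

section \<open>Indefinite integrals\<close>

text \<open>
  Absolute continuity of the integral. Truncating \<open>f\<close> at a level \<open>N\<close> costs less than \<open>\<epsilon>/2\<close> in the integral,
  and the truncated part contributes at most \<open>N\<close> times the measure of the set.
\<close>
lemma integrable_uniformly_small_on_small_sets:
  fixes f :: "real \<Rightarrow> real"
  assumes f: "integrable lborel f" and nonneg: "\<And>x. 0 \<le> f x" and \<epsilon>: "0 < \<epsilon>"
  obtains \<delta> where "0 < \<delta>"
    and "\<And>A. A \<in> sets borel \<Longrightarrow> emeasure lborel A < ennreal \<delta> \<Longrightarrow> (LINT x:A|lborel. f x) < \<epsilon>"
proof -
  have [measurable]: "f \<in> borel_measurable borel" using f by auto
  have trunc: "integrable lborel (\<lambda>x. f x - min (f x) (real n))" for n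
    by (rule Bochner_Integration.integrable_bound[OF f]) (use nonneg in auto)
  have "(\<lambda>n. LINT x|lborel. f x - min (f x) (real n)) \<longlonglongrightarrow> (LINT x|(lborel :: real measure). (0::real))"
  proof (rule integral_dominated_convergence[where w = f])
    show "AE x in lborel. (\<lambda>n. f x - min (f x) (real n)) \<longlonglongrightarrow> 0"
    proof (intro AE_I2 tendsto_eventually)
      fix x
      obtain N where "f x \<le> real N" using real_arch_simple by blast
      then show "\<forall>\<^sub>F n in sequentially. f x - min (f x) (real n) = 0"
        by (intro eventually_sequentiallyI[of N]) auto
    qed
  qed (use nonneg f in auto)
  then have "\<forall>\<^sub>F n in sequentially. (LINT x|lborel. f x - min (f x) (real n)) < \<epsilon> / 2"
    using \<epsilon> by (intro order_tendstoD(2)) auto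
  then obtain N where N: "(LINT x|lborel. f x - min (f x) (real N)) < \<epsilon> / 2"
    by (auto simp: eventually_sequentially)
  define \<delta> where "\<delta> = \<epsilon> / (2 * (real N + 1))"
  have \<delta>: "0 < \<delta>" using \<epsilon> by (simp add: \<delta>_def)
  show thesis
  proof (rule that[OF \<delta>])
    fix A :: "real set" assume A[measurable]: "A \<in> sets borel" and small: "emeasure lborel A < ennreal \<delta>"
    then have fin: "emeasure lborel A < \<infinity>" by (auto intro: less_trans)
    have m: "measure lborel A < \<delta>"
      using small \<delta> fin by (simp add: emeasure_eq_ennreal_measure ennreal_less_iff)
    have iA: "integrable lborel (\<lambda>x. real N * indicator A x)"
      using fin by (intro integrable_mult_right integrable_real_indicator) auto
    have "(LINT x:A|lborel. f x) \<le> (LINT x|lborel. (f x - min (f x) (real N)) + real N * indicator A x)"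
      unfolding set_lebesgue_integral_def
      by (intro integral_mono integrable_mult_indicator f Bochner_Integration.integrable_add trunc iA)
        (auto simp: indicator_def nonneg)
    also have "\<dots> = (LINT x|lborel. f x - min (f x) (real N)) + real N * measure lborel A"
      using trunc iA fin by (subst Bochner_Integration.integral_add) auto
    also have "\<dots> < \<epsilon> / 2 + (real N + 1) * \<delta>"
    proof -
      have "real N * measure lborel A \<le> (real N + 1) * \<delta>"
        using m by (intro mult_mono) auto
      with N show ?thesis by simp
    qed
    also have "\<dots> = \<epsilon>" by (simp add: \<delta>_def field_simps)
    finally show "(LINT x:A|lborel. f x) < \<epsilon>" .
  qed
qed

lemma set_integral_Ioo_eq_integral:
  fixes F :: "real \<Rightarrow> real"
  assumes "set_integrable lborel {a<..<b} F"
  shows "F integrable_on {a..b}" "(LINT s:{a<..<b}|lborel. F s) = integral {a..b} F"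
  using set_borel_integral_eq_integral[OF assms]
  by (simp_all add: integrable_on_open_interval_real integral_open_interval_real)

lemma set_integral_Ioo_diff:
  fixes F :: "real \<Rightarrow> real"
  assumes F: "set_integrable lborel {a<..<w} F" and uv: "a \<le> u" "u \<le> v" "v \<le> w"
  shows "(LINT s:{a<..<v}|lborel. F s) - (LINT s:{a<..<u}|lborel. F s) = (LINT s:{u<..<v}|lborel. F s)"
proof -
  have i: "set_integrable lborel {a<..<v} F" "set_integrable lborel {a<..<u} F" "set_integrable lborel {u<..<v} F"
    using uv by (auto intro!: set_integrable_subset[OF F])
  show ?thesis
    using Henstock_Kurzweil_Integration.integral_combine[OF uv(1,2) set_integral_Ioo_eq_integral(1)[OF i(1)]]
    by (simp add: i set_integral_Ioo_eq_integral(2))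
qed

lemma indefinite_integral_abs_continuous:
  fixes F :: "real \<Rightarrow> real"
  assumes F: "set_integrable lborel {0<..<T} F" and nonneg: "\<And>s. 0 < s \<Longrightarrow> 0 \<le> F s"
    and G: "\<And>t. 0 < t \<Longrightarrow> t \<le> T \<Longrightarrow> G t = c + (LINT s:{0<..<t}|lborel. F s)"
  shows "abs_continuous_on {0<..T} G"
  unfolding abs_continuous_on_def
proof (intro allI impI)
  fix \<epsilon> :: real assume "0 < \<epsilon>"
  define f where "f x = indicator {0<..<T} x * F x" for x
  have f: "integrable lborel f" using F by (simp add: set_integrable_def f_def[abs_def])
  have f0: "0 \<le> f x" for x using nonneg by (simp add: f_def indicator_def)
  obtain \<delta> where \<delta>: "0 < \<delta>"
    and small: "\<And>A. A \<in> sets borel \<Longrightarrow> emeasure lborel A < ennreal \<delta> \<Longrightarrow> (LINT x:A|lborel. f x) < \<epsilon>"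
    using integrable_uniformly_small_on_small_sets[OF f f0 \<open>0 < \<epsilon>\<close>] by blast
  show "\<exists>\<delta>>0. \<forall>(n::nat) u v. (\<forall>i<n. u i \<le> v i \<and> {u i..v i} \<subseteq> {0<..T}) \<longrightarrow>
        disjoint_family_on (\<lambda>i. {u i<..<v i}) {..<n} \<longrightarrow>
        (\<Sum>i<n. v i - u i) < \<delta> \<longrightarrow> (\<Sum>i<n. \<bar>G (v i) - G (u i)\<bar>) < \<epsilon>"
  proof (rule exI[of _ \<delta>], intro conjI \<delta> allI impI)
    fix n :: nat and u v :: "nat \<Rightarrow> real"
    assume uv: "\<forall>i<n. u i \<le> v i \<and> {u i..v i} \<subseteq> {0<..T}"
      and disj: "disjoint_family_on (\<lambda>i. {u i<..<v i}) {..<n}" and len: "(\<Sum>i<n. v i - u i) < \<delta>"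
    have uvi: "0 < u i" "u i \<le> v i" "v i \<le> T" if "i < n" for i
      using uv that by (auto dest!: spec[of _ i])
    let ?A = "\<Union>i\<in>{..<n}. {u i<..<v i}"
    have "emeasure lborel ?A = (\<Sum>i<n. emeasure lborel {u i<..<v i})"
      using disj by (intro sum_emeasure[symmetric]) auto
    also have "\<dots> = ennreal (\<Sum>i<n. v i - u i)"
      using uvi by (subst sum_ennreal[symmetric]) auto
    also have "\<dots> < ennreal \<delta>" using len \<delta> by (simp add: ennreal_lessI)
    finally have "(LINT x:?A|lborel. f x) < \<epsilon>" by (intro small) auto
    also have "(LINT x:?A|lborel. f x) = (\<Sum>i<n. LINT x:{u i<..<v i}|lborel. f x)"
      using disj f by (intro set_integral_finite_Union)
        (auto simp: set_integrable_def intro!: integrable_mult_indicator[where 'b = real, unfolded real_scaleR_def])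
    also have "\<dots> = (\<Sum>i<n. \<bar>G (v i) - G (u i)\<bar>)"
    proof (intro sum.cong refl)
      fix i assume "i \<in> {..<n}"
      then have i: "i < n" by simp
      note ui = uvi[OF i]
      have eq: "(LINT x:{u i<..<v i}|lborel. f x) = (LINT x:{u i<..<v i}|lborel. F x)"
        using ui by (intro set_lebesgue_integral_cong) (auto simp: f_def)
      have "0 \<le> (LINT x:{u i<..<v i}|lborel. f x)"
        using f0 unfolding set_lebesgue_integral_def by (intro Bochner_Integration.integral_nonneg) auto
      moreover have "G (v i) - G (u i) = (LINT x:{u i<..<v i}|lborel. F x)"
        using ui set_integral_Ioo_diff[OF F, of "u i" "v i"] by (simp add: G)
      ultimately show "(LINT x:{u i<..<v i}|lborel. f x) = \<bar>G (v i) - G (u i)\<bar>"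
        by (simp add: eq)
    qed
    finally show "(\<Sum>i<n. \<bar>G (v i) - G (u i)\<bar>) < \<epsilon>" .
  qed
qed

lemma indefinite_integral_derivative:
  fixes F :: "real \<Rightarrow> real"
  assumes F: "\<And>t. 0 < t \<Longrightarrow> set_integrable lborel {0<..<t} F" and cont: "continuous_on {0<..} F"
    and G: "\<And>t. 0 < t \<Longrightarrow> G t = c + (LINT s:{0<..<t}|lborel. F s)" and t: "0 < t"
  shows "(G has_real_derivative F t) (at t)"
proof -
  have int: "F integrable_on {0..t + 1}"
    using set_integral_Ioo_eq_integral(1)[OF F[of "t + 1"]] t by simp
  have "continuous (at t) F"
    using cont t continuous_on_eq_continuous_at[of "{0<..}" F] by auto
  then have "continuous (at t within {0..t + 1} - {}) F"
    by (auto intro: continuous_at_imp_continuous_at_within)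
  from integral_has_vector_derivative_continuous_at[OF int _ _ this]
  have "((\<lambda>u. integral {0..u} F) has_real_derivative F t) (at t within {0..t + 1})"
    using t by (simp add: has_real_derivative_iff_has_vector_derivative)
  moreover have "at t within {0..t + 1} = at t"
    using t by (intro at_within_interior) auto
  ultimately have "((\<lambda>u. c + integral {0..u} F) has_real_derivative F t) (at t)"
    by (auto intro!: derivative_eq_intros)
  then show ?thesis
  proof (rule DERIV_cong_ev[THEN iffD1, rotated -1])
    have "\<forall>\<^sub>F u in nhds t. 0 < u" using t by (intro eventually_nhds_in_open[of "{0<..}", simplified]) auto
    then show "\<forall>\<^sub>F u in nhds t. c + integral {0..u} F = G u"
      by eventually_elim (simp add: G set_integral_Ioo_eq_integral(2)[OF F])
  qed auto
qed

section \<open>From integrability to pointwise bounds\<close>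

text \<open>
  On \<open>[t/2, t]\<close> the function \<open>s\<^sup>\<beta> l(s)\<close> is at least its value at \<open>t\<close>, and changing the power of \<open>s\<close> costs only
  a constant factor \<open>m\<close> there, because \<open>s/t \<in> [1/2, 1]\<close>. Hence the \<open>p\<close>-th power integral over \<open>[t/2, t]\<close>
  bounds \<open>(t/2) (m t\<^sup>c l(t))\<^sup>p\<close> from above.
\<close>
lemma Lp_antimono_pointwise_bound:
  fixes l :: "real \<Rightarrow> real"
  assumes Lp: "in_Lp p {0..1} (\<lambda>t. t powr c * l t)" and p: "0 < p"
    and anti: "antimono_on {0<..} (\<lambda>t. t powr \<beta> * l t)" and nonneg: "\<forall>t>0. 0 \<le> t powr \<beta> * l t"
  obtains C where "0 \<le> C" and "\<And>t. 0 < t \<Longrightarrow> t \<le> 1 \<Longrightarrow> t powr c * l t \<le> C * t powr (- 1 / p)"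
proof -
  let ?M = "lebesgue_on {0..1::real}"
  let ?f = "\<lambda>t. t powr c * l t"
  \<comment> \<open>The minimum of \<open>\<theta> powr (c - \<beta>)\<close> over \<open>[1/2, 1]\<close>, whatever the sign of the exponent.\<close>
  define m where "m = min 1 ((1 / 2) powr (c - \<beta>))"
  define N where "N = (LINT s|?M. \<bar>?f s\<bar> powr p)"
  have m: "0 < m" by (simp add: m_def)
  have N: "0 \<le> N" unfolding N_def by (intro Bochner_Integration.integral_nonneg) auto
  have theta: "m \<le> \<theta> powr (c - \<beta>)" if "1 / 2 \<le> \<theta>" "\<theta> \<le> 1" for \<theta>
  proof (cases "0 \<le> c - \<beta>")
    case True
    then have "(1 / 2) powr (c - \<beta>) \<le> \<theta> powr (c - \<beta>)" using that by (intro powr_mono2) auto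
    then show ?thesis by (simp add: m_def)
  next
    case False
    then have "1 powr (c - \<beta>) \<le> \<theta> powr (c - \<beta>)" using that by (intro powr_mono2') auto
    then show ?thesis by (simp add: m_def)
  qed
  have l0: "0 \<le> l t" if "0 < t" for t
    using nonneg that by (auto simp: zero_le_mult_iff)
  show thesis
  proof (rule that[of "(2 * N) powr (1 / p) / m"])
    show "0 \<le> (2 * N) powr (1 / p) / m" using m by simp
    fix t :: real assume t: "0 < t" "t \<le> 1"
    have f0: "0 \<le> ?f t" using l0 t by simp
    have low: "m * ?f t \<le> ?f s" if s: "t / 2 \<le> s" "s \<le> t" for s
    proof -
      have "0 < s" using s t by simp
      have "m * t powr (c - \<beta>) \<le> (s / t) powr (c - \<beta>) * t powr (c - \<beta>)"
        using s t by (intro mult_right_mono theta) (auto simp: field_simps)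
      also have "\<dots> = s powr (c - \<beta>)"
        using t \<open>0 < s\<close> by (simp add: powr_divide)
      finally have 1: "m * t powr (c - \<beta>) \<le> s powr (c - \<beta>)" .
      have 2: "t powr \<beta> * l t \<le> s powr \<beta> * l s"
        using anti s t \<open>0 < s\<close> by (auto simp: monotone_on_def)
      have "(m * t powr (c - \<beta>)) * (t powr \<beta> * l t) \<le> s powr (c - \<beta>) * (s powr \<beta> * l s)"
        by (rule mult_mono[OF 1 2]) (use t l0[of t] in auto)
      moreover have "(m * t powr (c - \<beta>)) * (t powr \<beta> * l t) = m * (t powr (c - \<beta> + \<beta>) * l t)"
        unfolding powr_add by (simp only: mult_ac)
      moreover have "s powr (c - \<beta>) * (s powr \<beta> * l s) = s powr (c - \<beta> + \<beta>) * l s"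
        unfolding powr_add by (simp only: mult_ac)
      ultimately show ?thesis by simp
    qed
    have meas: "emeasure ?M {t / 2..t} = ennreal (t / 2)"
      using t by (subst emeasure_restrict_space) auto
    have int: "integrable ?M (\<lambda>s. (m * ?f t) powr p * indicator {t / 2..t} s)"
      using t meas by (intro integrable_mult_right integrable_real_indicator) (auto simp: sets_restrict_space_iff)
    have "(m * ?f t) powr p * (t / 2) = (LINT s|?M. (m * ?f t) powr p * indicator {t / 2..t} s)"
      using t meas int by (simp add: measure_def sets_restrict_space_iff)
    also have "\<dots> \<le> N"
      unfolding N_def
    proof (intro integral_mono int)
      show "integrable ?M (\<lambda>s. \<bar>?f s\<bar> powr p)" using Lp by (simp add: in_Lp_def)
      fix s
      show "(m * ?f t) powr p * indicator {t / 2..t} s \<le> \<bar>?f s\<bar> powr p"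
      proof (cases "s \<in> {t / 2..t}")
        case True
        then have "m * ?f t \<le> \<bar>?f s\<bar>" using low[of s] by auto
        then show ?thesis using True f0 m p by (auto intro!: powr_mono2)
      qed simp
    qed
    finally have "(m * ?f t) powr p \<le> 2 * N / t" using t by (simp add: field_simps)
    then have "((m * ?f t) powr p) powr (1 / p) \<le> (2 * N / t) powr (1 / p)"
      using p by (intro powr_mono2) auto
    moreover have "((m * ?f t) powr p) powr (1 / p) = m * ?f t"
      using p m f0 by (simp add: powr_powr)
    moreover have "(2 * N / t) powr (1 / p) = (2 * N) powr (1 / p) * t powr (- 1 / p)"
      using t N by (simp add: powr_divide powr_minus_divide)
    ultimately show "?f t \<le> (2 * N) powr (1 / p) / m * t powr (- 1 / p)"
      using m by (simp add: field_simps)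
  qed
qed

text \<open>
  With \<open>A\<^sup>1\<^sup>-\<^sup>\<mu> = P + Q + 1\<close> and \<open>A\<^sup>\<mu> \<ge> 1\<close> the left-hand side is at most \<open>(P + Q + 1) A\<^sup>\<mu> = A\<close>.
\<close>
lemma sublinear_bound_attained:
  fixes P Q \<mu> :: real
  assumes "0 \<le> P" "0 \<le> Q" "0 \<le> \<mu>" "\<mu> < 1"
  obtains A where "1 \<le> A" "P + Q * A powr \<mu> \<le> A"
proof
  let ?A = "(P + Q + 1) powr (1 / (1 - \<mu>))"
  show A1: "1 \<le> ?A" using assms by (intro ge_one_powr_ge_zero) auto
  have "1 \<le> ?A powr \<mu>" using A1 assms by (intro ge_one_powr_ge_zero) auto
  then have "P * 1 \<le> P * ?A powr \<mu>" using assms by (intro mult_left_mono) auto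
  moreover have "(P + Q + 1) * ?A powr \<mu> = P * ?A powr \<mu> + Q * ?A powr \<mu> + ?A powr \<mu>"
    by (simp only: distrib_right mult_1)
  ultimately have "P + Q * ?A powr \<mu> \<le> (P + Q + 1) * ?A powr \<mu>"
    using \<open>1 \<le> ?A powr \<mu>\<close> by linarith
  also have "(P + Q + 1) * ?A powr \<mu> = ?A"
  proof -
    have "?A powr (1 - \<mu>) = P + Q + 1" using assms by (simp add: powr_powr)
    moreover have "?A powr (1 - \<mu>) * ?A powr \<mu> = ?A powr (1 - \<mu> + \<mu>)" by (rule powr_add[symmetric])
    moreover have "?A powr (1 - \<mu> + \<mu>) = ?A" using A1 by simp
    ultimately show ?thesis by metis
  qed
  finally show "P + Q * ?A powr \<mu> \<le> ?A" .
qed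

section \<open>The Volterra equation\<close>

text \<open>
  The bounds on \<open>l\<close> and \<open>k\<close> say that \<open>l \<phi>(x) + k\<close> is \<open>O(t\<^sup>\<gamma>\<^sup>-\<^sup>1)\<close> at \<open>0\<close> whenever \<open>x\<close> is \<open>O(t\<^sup>\<beta>\<^sup>-\<^sup>1)\<close> and
  \<open>\<phi>\<close> grows like \<open>t\<^sup>\<mu>\<close>. The last assumption makes \<open>A t\<^sup>\<beta>\<^sup>-\<^sup>1\<close> an upper barrier on \<open>(0, 1]\<close>.
\<close>
locale sublinear_Volterra =
  fixes \<beta> \<gamma> \<mu> x\<^sub>0 M Cl Ck A :: real and \<phi> l k :: "real \<Rightarrow> real"
  assumes beta: "0 < \<beta>" "\<beta> < 1" and gamma: "0 < \<gamma>" and mu: "0 \<le> \<mu>" and x0: "0 < x\<^sub>0"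
    and coeffs_nonneg: "0 \<le> M" "0 \<le> Cl" "0 \<le> Ck"
    and phi_nonneg: "\<And>t. 0 \<le> t \<Longrightarrow> 0 \<le> \<phi> t"
    and phi_cont: "continuous_on {0..} \<phi>"
    and phi_mono: "mono_on {0..} \<phi>"
    and phi_bound: "\<And>t. 0 \<le> t \<Longrightarrow> \<phi> t \<le> M * npow t \<mu>"
    and l_nonneg: "\<And>t. 0 < t \<Longrightarrow> 0 \<le> l t"
    and l_antimono: "antimono_on {0<..} (\<lambda>t. t powr \<beta> * l t)"
    and l_bound: "\<And>t. 0 < t \<Longrightarrow> t \<le> 1 \<Longrightarrow> l t * t powr ((\<beta> - 1) * \<mu>) \<le> Cl * t powr (\<gamma> - 1)"
    and k_nonneg: "\<And>t. 0 < t \<Longrightarrow> 0 \<le> k t"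
    and k_antimono: "antimono_on {0<..} (\<lambda>t. t powr \<beta> * k t)"
    and k_bound: "\<And>t. 0 < t \<Longrightarrow> t \<le> 1 \<Longrightarrow> k t \<le> Ck * t powr (\<gamma> - 1)"
    and A_pos: "0 < A"
    and A_large: "x\<^sub>0 + (Cl * M * A powr \<mu> + Ck) * (Beta \<gamma> \<beta> / Gamma \<beta>) \<le> A"
begin

definition source_const :: real where "source_const = Cl * M * A powr \<mu> + Ck"

definition source :: "(real \<Rightarrow> real) \<Rightarrow> real \<Rightarrow> real" where
  "source x s = s powr \<beta> * (l s * \<phi> (x s) + k s)"

definition Volterra_map :: "(real \<Rightarrow> real) \<Rightarrow> real \<Rightarrow> real" where
  "Volterra_map x t = x\<^sub>0 * t powr (\<beta> - 1) + scaled_integral \<beta> (source x) t / Gamma \<beta>"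

lemma source_const_nonneg: "0 \<le> source_const" using coeffs_nonneg by (simp add: source_const_def)

lemma Gamma_pos: "0 < Gamma \<beta>" by (rule Gamma_real_pos[OF beta(1)])

lemma source_profile:
  assumes x: "decay_profile (\<beta> - 1) A x"
  shows "decay_profile (\<beta> + \<gamma> - 1) source_const (source x)"
proof -
  have x0: "0 \<le> x t" if "0 < t" for t using x that by (simp add: decay_profile_def)
  have xm: "x t \<le> x s" if "0 < s" "s \<le> t" for s t using x that by (auto simp: decay_profile_def monotone_on_def)
  have "antimono_on {0<..} (source x)"
  proof (rule monotone_onI)
    fix s t :: real assume "s \<in> {0<..}" "t \<in> {0<..}" and st: "s \<le> t"
    then have s: "0 < s" "0 < t" by auto
    have "\<phi> (x t) \<le> \<phi> (x s)"
      using phi_mono xm[OF s(1) st] x0 s by (auto simp: monotone_on_def)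
    moreover have "t powr \<beta> * l t \<le> s powr \<beta> * l s"
      using l_antimono st s by (auto simp: monotone_on_def)
    ultimately have "(t powr \<beta> * l t) * \<phi> (x t) \<le> (s powr \<beta> * l s) * \<phi> (x s)"
      using phi_nonneg[OF x0[OF s(2)]] l_nonneg[OF s(1)]
      by (intro mult_mono[of "t powr \<beta> * l t"]) auto
    moreover have "t powr \<beta> * k t \<le> s powr \<beta> * k s"
      using k_antimono st s by (auto simp: monotone_on_def)
    ultimately show "source x t \<le> source x s" by (simp add: source_def algebra_simps)
  qed
  moreover have "0 \<le> source x t" if "0 < t" for t
    using that l_nonneg k_nonneg phi_nonneg[OF x0] by (simp add: source_def)
  moreover have "source x t \<le> source_const * t powr (\<beta> + \<gamma> - 1)" if t: "0 < t" "t \<le> 1" for t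
  proof -
    have xb: "x t \<le> A * t powr (\<beta> - 1)" using x t by (simp add: decay_profile_def)
    have "npow (x t) \<mu> \<le> A powr \<mu> * t powr ((\<beta> - 1) * \<mu>)"
    proof (cases "\<mu> = 0")
      case True
      then show ?thesis using A_pos t by (simp add: npow_def)
    next
      case False
      have "x t powr \<mu> \<le> (A * t powr (\<beta> - 1)) powr \<mu>"
        using xb x0 t mu by (intro powr_mono2) auto
      then show ?thesis using False A_pos by (simp add: npow_def powr_mult powr_powr)
    qed
    then have "\<phi> (x t) \<le> M * (A powr \<mu> * t powr ((\<beta> - 1) * \<mu>))"
      using coeffs_nonneg by (intro order_trans[OF phi_bound[OF x0[OF t(1)]]] mult_left_mono) auto
    then have "l t * \<phi> (x t) \<le> l t * (M * (A powr \<mu> * t powr ((\<beta> - 1) * \<mu>)))"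
      using l_nonneg t by (intro mult_left_mono) auto
    also have "\<dots> = (M * A powr \<mu>) * (l t * t powr ((\<beta> - 1) * \<mu>))" by (simp only: mult_ac)
    also have "\<dots> \<le> (M * A powr \<mu>) * (Cl * t powr (\<gamma> - 1))"
      using l_bound[OF t] coeffs_nonneg by (intro mult_left_mono) auto
    finally have "l t * \<phi> (x t) + k t \<le> source_const * t powr (\<gamma> - 1)"
      using k_bound[OF t] by (simp add: source_const_def algebra_simps)
    then have "source x t \<le> t powr \<beta> * (source_const * t powr (\<gamma> - 1))"
      unfolding source_def by (intro mult_left_mono) auto
    also have "\<dots> = source_const * t powr (\<beta> + (\<gamma> - 1))" unfolding powr_add by simp
    finally show ?thesis by (simp add: add_diff_eq)
  qed
  ultimately show ?thesis by (simp add: decay_profile_def)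
qed

text \<open>
  The barrier is preserved: on \<open>(0, 1]\<close> the integral term is \<open>O(t\<^sup>\<beta>\<^sup>+\<^sup>\<gamma>\<^sup>-\<^sup>1)\<close>, hence \<open>O(t\<^sup>\<beta>\<^sup>-\<^sup>1)\<close> with the same
  constant, and the choice of \<open>A\<close> absorbs this constant.
\<close>
lemma Volterra_map_profile:
  assumes x: "decay_profile (\<beta> - 1) A x"
  shows "decay_profile (\<beta> - 1) A (Volterra_map x)"
proof -
  note S = source_profile[OF x]
  have "antimono_on {0<..} (Volterra_map x)"
  proof (rule monotone_onI)
    fix s t :: real assume st: "s \<in> {0<..}" "t \<in> {0<..}" "s \<le> t"
    have "t powr (\<beta> - 1) \<le> s powr (\<beta> - 1)" using st beta by (intro powr_mono2') auto
    moreover have "scaled_integral \<beta> (source x) t \<le> scaled_integral \<beta> (source x) s"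
      using scaled_integral_antimono[OF S beta(1) gamma] st by (auto simp: monotone_on_def)
    ultimately show "Volterra_map x t \<le> Volterra_map x s"
      unfolding Volterra_map_def using x0 Gamma_pos by (intro add_mono mult_left_mono divide_right_mono) auto
  qed
  moreover have "0 \<le> Volterra_map x t" if "0 < t" for t
    using scaled_integral_nonneg[OF S that] x0 Gamma_pos by (simp add: Volterra_map_def)
  moreover have "Volterra_map x t \<le> A * t powr (\<beta> - 1)" if t: "0 < t" "t \<le> 1" for t
  proof -
    have B: "0 \<le> Beta \<gamma> \<beta>"
      using beta gamma Gamma_real_pos[of "\<gamma> + \<beta>"] Gamma_real_pos[of \<gamma>] Gamma_pos by (simp add: Beta_def)
    have "scaled_integral \<beta> (source x) t \<le> source_const * Beta \<gamma> \<beta> * t powr (\<beta> + \<gamma> - 1)"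
      by (rule scaled_integral_bound[OF S beta(1) gamma t])
    also have "\<dots> \<le> source_const * Beta \<gamma> \<beta> * t powr (\<beta> - 1)"
      using t gamma B source_const_nonneg by (intro mult_left_mono powr_mono') auto
    finally have "scaled_integral \<beta> (source x) t / Gamma \<beta> \<le> source_const * Beta \<gamma> \<beta> * t powr (\<beta> - 1) / Gamma \<beta>"
      using Gamma_pos by (intro divide_right_mono) auto
    then have "Volterra_map x t \<le> (x\<^sub>0 + source_const * (Beta \<gamma> \<beta> / Gamma \<beta>)) * t powr (\<beta> - 1)"
      by (simp add: Volterra_map_def algebra_simps)
    also have "\<dots> \<le> A * t powr (\<beta> - 1)"
      using A_large by (intro mult_right_mono) (auto simp: source_const_def)
    finally show ?thesis .
  qed
  ultimately show ?thesis by (simp add: decay_profile_def)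
qed

lemma Volterra_map_mono:
  assumes x: "decay_profile (\<beta> - 1) A x" and y: "decay_profile (\<beta> - 1) A y"
    and le: "\<And>s. 0 < s \<Longrightarrow> x s \<le> y s" and t: "0 < t"
  shows "Volterra_map x t \<le> Volterra_map y t"
proof -
  have "scaled_integral \<beta> (source x) t \<le> scaled_integral \<beta> (source y) t"
  proof (rule scaled_integral_mono[OF source_profile[OF x] source_profile[OF y] beta(1) gamma t t])
    fix u :: real assume "0 < u" "u < 1"
    then have s: "0 < t * u" using t by simp
    have "0 \<le> x (t * u)" using x s by (simp add: decay_profile_def)
    then have "\<phi> (x (t * u)) \<le> \<phi> (y (t * u))"
      using phi_mono le[OF s] by (auto simp: monotone_on_def)
    then show "source x (t * u) \<le> source y (t * u)"
      unfolding source_def using l_nonneg[OF s] by (intro mult_left_mono add_right_mono) auto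
  qed
  then show ?thesis unfolding Volterra_map_def using Gamma_pos by (intro add_left_mono divide_right_mono) auto
qed

text \<open>
  Monotone iteration from \<open>0\<close>. The barrier and monotonicity in \<open>t\<close> bound the iterates at each point, so
  they converge; continuity of \<open>\<phi>\<close> and dominated convergence carry the recursion over to the limit.
\<close>
lemma fixed_point_exists:
  obtains x where "decay_profile (\<beta> - 1) A x" and "\<And>t. 0 < t \<Longrightarrow> x t = Volterra_map x t"
proof -
  define xs where "xs n = (Volterra_map ^^ n) (\<lambda>_. 0)" for n
  have xs_Suc: "xs (Suc n) = Volterra_map (xs n)" for n by (simp add: xs_def)
  have P: "decay_profile (\<beta> - 1) A (xs n)" for n
  proof (induction n)
    case 0
    show ?case using A_pos by (simp add: xs_def decay_profile_def monotone_on_def)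
  next
    case (Suc n)
    then show ?case unfolding xs_Suc by (rule Volterra_map_profile)
  qed
  have nonneg: "0 \<le> xs n t" if "0 < t" for n t using P[of n] that by (simp add: decay_profile_def)
  have step: "xs n t \<le> xs (Suc n) t" if "0 < t" for n t
    using that
  proof (induction n arbitrary: t)
    case 0
    then show ?case using nonneg[of t "Suc 0"] by (simp add: xs_def)
  next
    case (Suc n)
    have "Volterra_map (xs n) t \<le> Volterra_map (xs (Suc n)) t"
      by (rule Volterra_map_mono[OF P P Suc.IH Suc.prems])
    then show ?case by (simp only: xs_Suc)
  qed
  have bdd: "xs n t \<le> A * (min t 1) powr (\<beta> - 1)" if "0 < t" for n t
  proof -
    have "xs n t \<le> xs n (min t 1)" using P[of n] that by (auto simp: decay_profile_def monotone_on_def)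
    also have "\<dots> \<le> A * (min t 1) powr (\<beta> - 1)" using P[of n] that by (auto simp: decay_profile_def)
    finally show ?thesis .
  qed
  define x where "x t = lim (\<lambda>n. xs n t)" for t
  have lim: "(\<lambda>n. xs n t) \<longlonglongrightarrow> x t" if "0 < t" for t
  proof -
    have "incseq (\<lambda>n. xs n t)" using step[OF that] by (intro incseq_SucI)
    from incseq_convergent[OF this] bdd[OF that] obtain L where "(\<lambda>n. xs n t) \<longlonglongrightarrow> L" by blast
    then show ?thesis unfolding x_def by (simp add: limI)
  qed
  have xP: "decay_profile (\<beta> - 1) A x"
    unfolding decay_profile_def
  proof (intro conjI monotone_onI allI impI)
    fix s t :: real assume st: "s \<in> {0<..}" "t \<in> {0<..}" "s \<le> t"
    show "x t \<le> x s"
      by (rule LIMSEQ_le[OF lim lim]) (use st P in \<open>auto simp: decay_profile_def monotone_on_def\<close>)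
  next
    fix t :: real assume "0 < t"
    show "0 \<le> x t" by (rule LIMSEQ_le_const[OF lim]) (use \<open>0 < t\<close> nonneg in auto)
  next
    fix t :: real assume t: "0 < t \<and> t \<le> 1"
    show "x t \<le> A * t powr (\<beta> - 1)"
      by (rule LIMSEQ_le_const2[OF lim]) (use t P in \<open>auto simp: decay_profile_def\<close>)
  qed
  have fix_eq: "x t = Volterra_map x t" if t: "0 < t" for t
  proof -
    have src: "(\<lambda>n. source (xs n) s) \<longlonglongrightarrow> source x s" if s: "0 < s" for s
    proof -
      have "(\<lambda>n. \<phi> (xs n s)) \<longlonglongrightarrow> \<phi> (x s)"
        by (rule continuous_on_tendsto_compose[OF phi_cont lim[OF s]])
          (use s nonneg xP in \<open>auto simp: decay_profile_def\<close>)
      then show ?thesis unfolding source_def by (intro tendsto_intros)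
    qed
    have "(\<lambda>n. scaled_integral \<beta> (source (xs n)) t) \<longlonglongrightarrow> scaled_integral \<beta> (source x) t"
      by (rule scaled_integral_tendsto[OF source_profile[OF xP] source_profile[OF P] beta(1) gamma, of "min t 1"])
        (use t src in auto)
    then have "(\<lambda>n. xs (Suc n) t) \<longlonglongrightarrow> Volterra_map x t"
      unfolding xs_Suc Volterra_map_def using Gamma_pos by (intro tendsto_intros) auto
    moreover have "(\<lambda>n. xs (Suc n) t) \<longlonglongrightarrow> x t" using lim[OF t] by (rule LIMSEQ_Suc)
    ultimately show ?thesis by (metis LIMSEQ_unique)
  qed
  show thesis using that xP fix_eq by blast
qed

text \<open>
  After multiplication by \<open>t\<^sup>1\<^sup>-\<^sup>\<beta>\<close> the integral term lies between \<open>0\<close> and a multiple of \<open>t\<^sup>\<gamma>\<close>.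
\<close>
lemma fixed_point_limit_0:
  assumes x: "decay_profile (\<beta> - 1) A x" and fp: "\<And>t. 0 < t \<Longrightarrow> x t = Volterra_map x t"
  shows "((\<lambda>t. t powr (1 - \<beta>) * x t) \<longlongrightarrow> x\<^sub>0) (at_right 0)"
proof -
  note S = source_profile[OF x]
  let ?D = "source_const * Beta \<gamma> \<beta> / Gamma \<beta>"
  have ev: "\<forall>\<^sub>F t in at_right 0. 0 < t \<and> t < (1::real)"
    by (auto simp: eventually_at_right_field intro: exI[of _ 1])
  have eq: "t powr (1 - \<beta>) * x t = x\<^sub>0 + t powr (1 - \<beta>) * (scaled_integral \<beta> (source x) t / Gamma \<beta>)" if "0 < t" for t
    using that fp[OF that] by (simp add: Volterra_map_def algebra_simps powr_add[symmetric])
  have up: "t powr (1 - \<beta>) * x t \<le> x\<^sub>0 + ?D * t powr \<gamma>" if t: "0 < t" "t < 1" for t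
  proof -
    have "scaled_integral \<beta> (source x) t / Gamma \<beta> \<le> source_const * Beta \<gamma> \<beta> * t powr (\<beta> + \<gamma> - 1) / Gamma \<beta>"
      using scaled_integral_bound[OF S beta(1) gamma] t Gamma_pos by (intro divide_right_mono) auto
    then have "t powr (1 - \<beta>) * (scaled_integral \<beta> (source x) t / Gamma \<beta>)
        \<le> t powr (1 - \<beta>) * (source_const * Beta \<gamma> \<beta> * t powr (\<beta> + \<gamma> - 1) / Gamma \<beta>)"
      by (rule mult_left_mono) simp
    also have "\<dots> = ?D * (t powr (1 - \<beta>) * t powr (\<beta> + \<gamma> - 1))" by simp
    also have "t powr (1 - \<beta>) * t powr (\<beta> + \<gamma> - 1) = t powr \<gamma>" by (simp add: powr_add[symmetric])
    finally show ?thesis using eq[OF t(1)] by simp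
  qed
  have low: "x\<^sub>0 \<le> t powr (1 - \<beta>) * x t" if "0 < t" for t
    using eq[OF that] scaled_integral_nonneg[OF S that] Gamma_pos by simp
  have "((\<lambda>t::real. t powr \<gamma>) \<longlongrightarrow> 0) (at_right 0)"
    using gamma by (intro tendsto_zero_powrI[where b = \<gamma>] tendsto_ident_at tendsto_const)
      (auto simp: eventually_at_filter)
  then have "((\<lambda>t. x\<^sub>0 + ?D * t powr \<gamma>) \<longlongrightarrow> x\<^sub>0 + ?D * 0) (at_right 0)" by (intro tendsto_intros)
  then have upper: "((\<lambda>t. x\<^sub>0 + ?D * t powr \<gamma>) \<longlongrightarrow> x\<^sub>0) (at_right 0)" by simp
  show ?thesis
  proof (rule tendsto_sandwich[OF _ _ tendsto_const upper])
    show "\<forall>\<^sub>F t in at_right 0. x\<^sub>0 \<le> t powr (1 - \<beta>) * x t"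
      using ev by (rule eventually_mono) (blast intro: low)
    show "\<forall>\<^sub>F t in at_right 0. t powr (1 - \<beta>) * x t \<le> x\<^sub>0 + ?D * t powr \<gamma>"
      using ev by (rule eventually_mono) (blast intro: up)
  qed
qed

lemma fixed_point_in_C_plus:
  assumes x: "decay_profile (\<beta> - 1) A x" and fp: "\<And>t. 0 < t \<Longrightarrow> x t = Volterra_map x t"
  shows "x \<in> C_plus (1 - \<beta>)"
proof -
  have nonneg: "0 \<le> x t" if "0 < t" for t using x that by (simp add: decay_profile_def)
  have "continuous_on {0<..} (Volterra_map x)"
    unfolding Volterra_map_def using Gamma_pos
    by (intro continuous_intros scaled_integral_continuous[OF source_profile[OF x] beta(1) gamma]) auto
  then have cont: "continuous_on {0<..} x"
    by (rule continuous_on_eq) (use fp in auto)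
  define g where "g t = (if t = 0 then x\<^sub>0 else t powr (1 - \<beta>) * x t)" for t
  have "continuous (at t within {0..}) g" if "0 \<le> t" for t
  proof (cases "t = 0")
    case True
    have "(g \<longlongrightarrow> x\<^sub>0) (at_right 0)"
      using fixed_point_limit_0[OF x fp]
      by (rule Lim_transform_eventually) (auto simp: g_def eventually_at_filter)
    then show ?thesis using True by (simp add: continuous_within g_def at_within_Ici_at_right)
  next
    case False
    with that have t: "0 < t" by simp
    have "continuous_on {0<..} (\<lambda>t. t powr (1 - \<beta>) * x t)"
      by (intro continuous_intros cont) auto
    then have "continuous_on {0<..} g"
      by (rule continuous_on_eq) (auto simp: g_def)
    then have "isCont g t" using t by (auto simp: continuous_on_eq_continuous_at)
    then show ?thesis by (rule continuous_at_imp_continuous_at_within)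
  qed
  then have "continuous_on {0..} g" by (simp add: continuous_on_eq_continuous_within)
  moreover have "\<forall>t\<ge>0. 0 \<le> g t" using nonneg x0 by (simp add: g_def)
  moreover have "\<forall>t>0. g t = t powr (1 - \<beta>) * x t" by (simp add: g_def)
  ultimately show ?thesis
    unfolding C_plus_def using cont nonneg by blast
qed

lemma fixed_point_strict_antimono:
  assumes x: "decay_profile (\<beta> - 1) A x" and fp: "\<And>t. 0 < t \<Longrightarrow> x t = Volterra_map x t"
  shows "strict_antimono_on {0<..} x"
proof (rule monotone_onI)
  fix s t :: real assume st: "s \<in> {0<..}" "t \<in> {0<..}" "s < t"
  have "t powr (\<beta> - 1) < s powr (\<beta> - 1)" using st beta by (intro powr_less_mono2_neg) auto
  moreover have "scaled_integral \<beta> (source x) t \<le> scaled_integral \<beta> (source x) s"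
    using scaled_integral_antimono[OF source_profile[OF x] beta(1) gamma] st by (auto simp: monotone_on_def)
  ultimately have "Volterra_map x t < Volterra_map x s"
    unfolding Volterra_map_def using x0 Gamma_pos
    by (intro add_less_le_mono mult_strict_left_mono divide_right_mono) auto
  then show "x t < x s" using fp st by simp
qed

text \<open>
  Since \<open>x\<close> is nonincreasing, \<open>\<phi>(x(t)) \<le> \<phi>(x(1))\<close> for \<open>t \<ge> 1\<close>, so the decay of \<open>t\<^sup>\<beta> l(t)\<close> and
  \<open>t\<^sup>\<beta> k(t)\<close> passes to the source and from there to its scaled integral.
\<close>
lemma fixed_point_at_top:
  assumes x: "decay_profile (\<beta> - 1) A x" and fp: "\<And>t. 0 < t \<Longrightarrow> x t = Volterra_map x t"
    and l_lim: "((\<lambda>t. t powr \<beta> * l t) \<longlongrightarrow> 0) at_top" and k_lim: "((\<lambda>t. t powr \<beta> * k t) \<longlongrightarrow> 0) at_top"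
  shows "(x \<longlongrightarrow> 0) at_top"
proof -
  note S = source_profile[OF x]
  have ev: "\<forall>\<^sub>F t in at_top. (1::real) \<le> t" by (rule eventually_ge_at_top)
  have "((\<lambda>t. t powr \<beta> * l t * \<phi> (x 1) + t powr \<beta> * k t) \<longlongrightarrow> 0 * \<phi> (x 1) + 0) at_top"
    by (intro tendsto_intros l_lim k_lim)
  then have dom: "((\<lambda>t. t powr \<beta> * l t * \<phi> (x 1) + t powr \<beta> * k t) \<longlongrightarrow> 0) at_top" by simp
  have "(source x \<longlongrightarrow> 0) at_top"
  proof (rule tendsto_sandwich[OF _ _ tendsto_const dom])
    show "\<forall>\<^sub>F t in at_top. 0 \<le> source x t"
      using ev by (rule eventually_mono) (use S in \<open>auto simp: decay_profile_def\<close>)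
    show "\<forall>\<^sub>F t in at_top. source x t \<le> t powr \<beta> * l t * \<phi> (x 1) + t powr \<beta> * k t"
      using ev
    proof eventually_elim
      case (elim t)
      have "\<phi> (x t) \<le> \<phi> (x 1)"
        using phi_mono x elim by (auto simp: decay_profile_def monotone_on_def)
      then have "t powr \<beta> * l t * \<phi> (x t) \<le> t powr \<beta> * l t * \<phi> (x 1)"
        using l_nonneg[of t] elim by (intro mult_left_mono) auto
      then show ?case by (simp add: source_def algebra_simps)
    qed
  qed
  then have V: "(scaled_integral \<beta> (source x) \<longlongrightarrow> 0) at_top"
    by (rule scaled_integral_at_top[OF S beta(1) gamma source_const_nonneg])
  have "((\<lambda>t::real. t powr (\<beta> - 1)) \<longlongrightarrow> 0) at_top"
    using beta by (intro tendsto_neg_powr filterlim_ident) auto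
  then have "((\<lambda>t. Volterra_map x t) \<longlongrightarrow> x\<^sub>0 * 0 + 0 / Gamma \<beta>) at_top"
    unfolding Volterra_map_def using V Gamma_pos by (intro tendsto_intros) auto
  then have "((\<lambda>t. Volterra_map x t) \<longlongrightarrow> 0) at_top" by simp
  then show ?thesis
    by (rule Lim_transform_eventually) (use ev in \<open>rule eventually_mono\<close>, simp add: fp)
qed

text \<open>
  The fixed point equation has continuous right-hand side, so \<open>x\<close> and with it the density
  \<open>l \<phi>(x) + k\<close> are continuous. This upgrades the derivative of \<open>I\<^sup>1\<^sup>-\<^sup>\<beta> x\<close> from almost everywhere to everywhere.
\<close>
lemma fixed_point_is_solution:
  assumes x: "decay_profile (\<beta> - 1) A x" and fp: "\<And>t. 0 < t \<Longrightarrow> x t = Volterra_map x t"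
    and l_cont: "continuous_on {0<..} (\<lambda>t. t powr \<beta> * l t)"
    and k_cont: "continuous_on {0<..} (\<lambda>t. t powr \<beta> * k t)"
  shows "is_solution \<beta> l \<phi> k x\<^sub>0 x"
proof -
  note S = source_profile[OF x]
  have nonneg: "0 \<le> x t" if "0 < t" for t using x that by (simp add: decay_profile_def)
  have x_eq: "x s = x\<^sub>0 * s powr (\<beta> - 1) + scaled_integral \<beta> (source x) s / Gamma \<beta>" if "0 < s" for s
    using fp[OF that] by (simp add: Volterra_map_def)
  let ?F = "\<lambda>s. s powr (- \<beta>) * source x s"
  have F: "set_integrable lborel {0<..<t} ?F" if "0 < t" for t
    by (rule decay_profile_weighted_integrable[OF S beta gamma that])
  have F_eq: "?F t = l t * \<phi> (x t) + k t" if "0 < t" for t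
    using that by (simp add: source_def mult.assoc[symmetric] powr_add[symmetric])
  have F0: "0 \<le> ?F t" if "0 < t" for t using S that by (simp add: decay_profile_def)
  have RL: "RL_integral (1 - \<beta>) x t = x\<^sub>0 * Gamma \<beta> + (LINT s:{0<..<t}|lborel. ?F s)" if "0 < t" for t
    using RL_integral_of_Volterra(2)[OF S beta gamma less_imp_le[OF x0] that x_eq] .
  have cx: "continuous_on {0<..} x" using fixed_point_in_C_plus[OF x fp] by (simp add: C_plus_def)
  have "continuous_on {0<..} (\<lambda>t. \<phi> (x t))"
    by (rule continuous_on_compose2[OF phi_cont cx]) (use nonneg in auto)
  then have "continuous_on {0<..} (\<lambda>t. (t powr \<beta> * l t) * \<phi> (x t) + t powr \<beta> * k t)"
    by (intro continuous_intros l_cont k_cont)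
  then have "continuous_on {0<..} (source x)" by (simp add: source_def[abs_def] algebra_simps)
  then have cF: "continuous_on {0<..} ?F" by (intro continuous_intros) auto
  have "RL_differentiable \<beta> x"
    unfolding RL_differentiable_def
  proof (intro conjI allI impI)
    fix t :: real assume "0 < t"
    then show "set_integrable lebesgue {0<..<t} (\<lambda>s. (t - s) powr (- \<beta>) * x s)"
      using RL_integral_of_Volterra(1)[OF S beta gamma less_imp_le[OF x0] _ x_eq] by blast
    show "abs_continuous_on {0<..t} (RL_integral (1 - \<beta>) x)"
      by (rule indefinite_integral_abs_continuous[OF F[OF \<open>0 < t\<close>] F0 RL])
  qed
  moreover have "(RL_integral (1 - \<beta>) x has_real_derivative l t * \<phi> (x t) + k t) (at t)" if "0 < t" for t
    using indefinite_integral_derivative[OF F cF RL that] F_eq[OF that] by simp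
  ultimately show ?thesis
    unfolding is_solution_def has_RL_derivative_def using fixed_point_limit_0[OF x fp] by auto
qed

end

section \<open>The initial value problem\<close>

theorem theorem3p4:
  fixes \<beta> x\<^sub>0 \<mu> p a b :: real and \<phi> l k :: "real \<Rightarrow> real"
  assumes "0 < \<beta>" "\<beta> < 1" and "x\<^sub>0 > 0" and "0 \<le> \<mu>" "\<mu> < 1" and "p > 1 / \<beta>"
    and phi_nonneg: "\<forall>t\<ge>0. 0 \<le> \<phi> t"
    and phi_cont: "continuous_on {0..} \<phi>"
    and phi_mono: "mono_on {0..} \<phi>"
    and phi_bound: "\<exists>M\<ge>0. \<forall>t\<ge>0. \<bar>\<phi> t\<bar> \<le> M * npow t \<mu>"
    and l_nonneg: "\<forall>t>0. 0 \<le> t powr \<beta> * l t"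
    and l_cont: "continuous_on {0<..} (\<lambda>t. t powr \<beta> * l t)"
    and l_antimono: "antimono_on {0<..} (\<lambda>t. t powr \<beta> * l t)"
    and l_Lp: "in_Lp p {0..1} (\<lambda>t. t powr ((1 - \<mu>) * (1 - \<beta>)) * l t)"
    and k_nonneg: "\<forall>t>0. 0 \<le> t powr \<beta> * k t"
    and k_cont: "continuous_on {0<..} (\<lambda>t. t powr \<beta> * k t)"
    and k_antimono: "antimono_on {0<..} (\<lambda>t. t powr \<beta> * k t)"
    and k_Lp: "in_Lp p {0..1} (\<lambda>t. t powr (1 - \<beta>) * k t)"
    and a_lim: "((\<lambda>t. t powr \<beta> * l t) \<longlongrightarrow> a) at_top"
    and b_lim: "((\<lambda>t. t powr \<beta> * k t) \<longlongrightarrow> b) at_top"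
    and "a = 0" "b = 0"
  shows "\<exists>x \<in> C_plus (1 - \<beta>). is_solution \<beta> l \<phi> k x\<^sub>0 x \<and>
           strict_antimono_on {0<..} x \<and> (x \<longlongrightarrow> 0) at_top"
proof -
  have "0 < 1 / \<beta>" using \<open>0 < \<beta>\<close> by simp
  then have p: "0 < p" using \<open>p > 1 / \<beta>\<close> by linarith
  define \<gamma> where "\<gamma> = \<beta> - 1 / p"
  have \<gamma>: "0 < \<gamma>" using \<open>p > 1 / \<beta>\<close> \<open>0 < \<beta>\<close> p by (simp add: \<gamma>_def field_simps)
  obtain Cl where Cl: "0 \<le> Cl"
    "\<And>t. 0 < t \<Longrightarrow> t \<le> 1 \<Longrightarrow> t powr ((1 - \<mu>) * (1 - \<beta>)) * l t \<le> Cl * t powr (- 1 / p)"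
    using Lp_antimono_pointwise_bound[OF l_Lp p l_antimono l_nonneg] by blast
  obtain Ck where Ck: "0 \<le> Ck"
    "\<And>t. 0 < t \<Longrightarrow> t \<le> 1 \<Longrightarrow> t powr (1 - \<beta>) * k t \<le> Ck * t powr (- 1 / p)"
    using Lp_antimono_pointwise_bound[OF k_Lp p k_antimono k_nonneg] by blast
  obtain M where M: "0 \<le> M" "\<And>t. 0 \<le> t \<Longrightarrow> \<bar>\<phi> t\<bar> \<le> M * npow t \<mu>"
    using phi_bound by blast
  have "0 \<le> Beta \<gamma> \<beta> / Gamma \<beta>"
    using \<gamma> \<open>0 < \<beta>\<close> Gamma_real_pos[of "\<gamma> + \<beta>"] Gamma_real_pos[of \<gamma>] Gamma_real_pos[of \<beta>]
    by (simp add: Beta_def)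
  then obtain A where A: "1 \<le> A"
    "(x\<^sub>0 + Ck * (Beta \<gamma> \<beta> / Gamma \<beta>)) + (Cl * M * (Beta \<gamma> \<beta> / Gamma \<beta>)) * A powr \<mu> \<le> A"
    using sublinear_bound_attained[of "x\<^sub>0 + Ck * (Beta \<gamma> \<beta> / Gamma \<beta>)" "Cl * M * (Beta \<gamma> \<beta> / Gamma \<beta>)" \<mu>]
      Cl(1) Ck(1) M(1) \<open>x\<^sub>0 > 0\<close> \<open>0 \<le> \<mu>\<close> \<open>\<mu> < 1\<close> by (metis add_nonneg_nonneg less_imp_le mult_nonneg_nonneg)
  \<comment> \<open>Multiplying by \<open>t powr (\<beta> - 1)\<close> converts the exponent \<open>-1/p\<close> into \<open>\<gamma> - 1\<close>.\<close>
  have weight: "c * (t powr r * t powr (\<beta> - 1)) \<le> D * t powr (\<gamma> - 1)"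
    if "t powr r * c \<le> D * t powr (- 1 / p)" for c r D t
  proof -
    have "(t powr r * c) * t powr (\<beta> - 1) \<le> (D * t powr (- 1 / p)) * t powr (\<beta> - 1)"
      using that by (rule mult_right_mono) simp
    also have "\<dots> = D * t powr (- 1 / p + (\<beta> - 1))" by (simp only: powr_add mult.assoc)
    also have "- 1 / p + (\<beta> - 1) = \<gamma> - 1" by (simp add: \<gamma>_def)
    finally show ?thesis by (simp only: mult_ac)
  qed
  interpret sublinear_Volterra \<beta> \<gamma> \<mu> x\<^sub>0 M Cl Ck A \<phi> l k
  proof
    show "0 \<le> l t" "0 \<le> k t" if "0 < t" for t
      using l_nonneg k_nonneg that by (auto simp: zero_le_mult_iff)
    show "l t * t powr ((\<beta> - 1) * \<mu>) \<le> Cl * t powr (\<gamma> - 1)" if "0 < t" "t \<le> 1" for t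
    proof -
      have "t powr ((1 - \<mu>) * (1 - \<beta>)) * t powr (\<beta> - 1) = t powr ((\<beta> - 1) * \<mu>)"
        by (simp add: powr_add[symmetric] algebra_simps)
      with weight[OF Cl(2)[OF that]] show ?thesis by simp
    qed
    show "k t \<le> Ck * t powr (\<gamma> - 1)" if "0 < t" "t \<le> 1" for t
      using weight[OF Ck(2)[OF that]] that by (simp add: powr_add[symmetric])
    show "\<phi> t \<le> M * npow t \<mu>" if "0 \<le> t" for t using M(2)[OF that] by simp
    show "x\<^sub>0 + (Cl * M * A powr \<mu> + Ck) * (Beta \<gamma> \<beta> / Gamma \<beta>) \<le> A"
      using A(2) by (simp add: algebra_simps)
  qed (use assms \<gamma> Cl(1) Ck(1) M(1) A(1) in auto)
  obtain x where x: "decay_profile (\<beta> - 1) A x" and fp: "\<And>t. 0 < t \<Longrightarrow> x t = Volterra_map x t"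
    using fixed_point_exists by blast
  show ?thesis
  proof (intro bexI conjI)
    show "x \<in> C_plus (1 - \<beta>)" by (rule fixed_point_in_C_plus[OF x fp])
    show "is_solution \<beta> l \<phi> k x\<^sub>0 x" by (rule fixed_point_is_solution[OF x fp l_cont k_cont])
    show "strict_antimono_on {0<..} x" by (rule fixed_point_strict_antimono[OF x fp])
    show "(x \<longlongrightarrow> 0) at_top"
      using a_lim b_lim \<open>a = 0\<close> \<open>b = 0\<close> by (intro fixed_point_at_top[OF x fp]) auto
  qed
qed

end
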